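(* Let $p\in(1,2)$. There exist constants $C,D>0$ (depending only on $p$) such that for all integers $n>1$, $$C\Big(\frac{\log n}{n}\Big)^{\frac{2-p}{2p}}\le r_p^n(\mathbb C)\le D\Big(\frac{\log n}{n}\Big)^{\frac{2-p}{2p}}.$$
   Context: For a complex Banach space $X$, $p\in[1,\infty)$ and a holomorphic $f:\mathbb D^n\to X$ ($\mathbb D^n$ the open unit polydisk), $f(z)=x_0+\sum_{|\alpha|\ge1}x_\alpha z^\alpha$ (multi-index notation), with $\sup_{z\in\mathbb D^n}\|f(z)\|\le1$, let $r_p^n(f,X)=\sup\{r\ge0:\|x_0\|^p+\sum_{k\ge1}\sum_{|\alpha|=k}\|x_\alpha z^\alpha\|^p\le1\ \forall z\in r\mathbb D^n\}$ and $r_p^n(X)=\inf$ of $r_p^n(f,X)$ over all such $f$ (the $n$-dimensional $p$-Bohr radius). *)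

theory Defs
  imports "HOL-Analysis.Analysis" "HOL-Library.Extended_Real"
begin

text \<open>Points of C^n are modelled as functions nat => complex that vanish
  outside the coordinates 0..n-1; multi-indices as functions nat => nat
  vanishing outside 0..n-1.\<close>

definition multi_indices :: "nat \<Rightarrow> (nat \<Rightarrow> nat) set" where
  "multi_indices n = {\<alpha>. \<forall>i\<ge>n. \<alpha> i = 0}"

definition polydisk :: "nat \<Rightarrow> real \<Rightarrow> (nat \<Rightarrow> complex) set" where
  "polydisk n r = {z. (\<forall>i<n. cmod (z i) < r) \<and> (\<forall>i\<ge>n. z i = 0)}"

definition monom :: "nat \<Rightarrow> (nat \<Rightarrow> complex) \<Rightarrow> (nat \<Rightarrow> nat) \<Rightarrow> complex" where
  "monom n z \<alpha> = (\<Prod>i<n. z i ^ \<alpha> i)"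

text \<open>f is holomorphic on the open unit polydisk (separately holomorphic in each
  variable, which by Hartogs' theorem is holomorphy), its power series expansion
  with coefficients c converges to f on the polydisk, and sup |f| <= 1.\<close>
definition bohr_admissible ::
  "nat \<Rightarrow> ((nat \<Rightarrow> complex) \<Rightarrow> complex) \<Rightarrow> ((nat \<Rightarrow> nat) \<Rightarrow> complex) \<Rightarrow> bool" where
  "bohr_admissible n f c \<longleftrightarrow>
     (\<forall>z\<in>polydisk n 1. \<forall>i<n. (\<lambda>w. f (z(i := w))) field_differentiable (at (z i))) \<and>
     (\<forall>z\<in>polydisk n 1. ((\<lambda>\<alpha>. c \<alpha> * monom n z \<alpha>) has_sum f z) (multi_indices n)) \<and>
     (\<forall>z\<in>polydisk n 1. cmod (f z) \<le> 1)"

text \<open>The p-Bohr condition at z: |x_0|^p + sum_{k>=1} sum_{|alpha|=k} |x_alpha z^alpha|^p <= 1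
  (a sum of nonnegative terms, so it is the unordered sum over all multi-indices,
  including alpha = 0 which gives |x_0|^p).\<close>
definition bohr_cond :: "real \<Rightarrow> nat \<Rightarrow> ((nat \<Rightarrow> nat) \<Rightarrow> complex) \<Rightarrow> (nat \<Rightarrow> complex) \<Rightarrow> bool" where
  "bohr_cond p n c z \<longleftrightarrow>
     (\<lambda>\<alpha>. (cmod (c \<alpha> * monom n z \<alpha>)) powr p) summable_on (multi_indices n) \<and>
     (\<Sum>\<^sub>\<infinity>\<alpha>\<in>multi_indices n. (cmod (c \<alpha> * monom n z \<alpha>)) powr p) \<le> 1"

text \<open>r_p^n(f): supremum (in the extended reals, so that it may be infinite) of the r >= 0
  such that the p-Bohr condition holds on r D^n.\<close>
definition bohr_radius_f :: "real \<Rightarrow> nat \<Rightarrow> ((nat \<Rightarrow> nat) \<Rightarrow> complex) \<Rightarrow> ereal" where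
  "bohr_radius_f p n c = (SUP r\<in>{r::real. r \<ge> 0 \<and> (\<forall>z\<in>polydisk n r. bohr_cond p n c z)}. ereal r)"

definition bohr_radius :: "real \<Rightarrow> nat \<Rightarrow> ereal" where
  "bohr_radius p n = (INF fc\<in>{(f, c). bohr_admissible n f c}. bohr_radius_f p n (snd fc))"

end

theory Submission
  imports Defs "HOL-Complex_Analysis.Cauchy_Integral_Formula"
begin

text \<open>
  Lower bound. If \<open>|f| \<le> 1\<close>, each homogeneous part \<open>P = \<Sum> c\<^sub>\<alpha> z\<^sup>\<alpha>\<close> of degree \<open>m \<ge> 1\<close> is bounded
  by \<open>B = 2 (1 - |c\<^sub>0|)\<close>. Hence \<open>\<Sum> |c\<^sub>\<alpha>|\<^sup>2 \<le> B\<^sup>2\<close>, and interpolation with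
  \<open>\<Sum> |c\<^sub>\<alpha>| \<le> B K\<^sup>m (n / ln n)\<^bsup>m/2\<^esup>\<close> bounds \<open>\<Sum> |c\<^sub>\<alpha>|\<^sup>p\<close>. For \<open>m \<ge> ln n\<close> the
  \<open>\<ell>\<^sup>1\<close> estimate is Cauchy--Schwarz together with a count of the multi-indices. For \<open>m < ln n\<close> one
  saves a factor \<open>\<surd>n\<close> by applying Cauchy--Schwarz to the derivatives \<open>z\<^sub>j \<partial>\<^sub>jP\<close> separately: their
  \<open>L\<^sup>2\<close> norms are at most \<open>C\<^sup>m\<close> times their \<open>L\<^sup>1\<close> norms, and \<open>\<Sum>\<^sub>j |z\<^sub>j \<partial>\<^sub>jP(z)| \<le> e m B\<close>
  pointwise. Averages over the torus are replaced by averages over roots of unity.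

  Upper bound. With \<open>m \<approx> ln n\<close> blocks of \<open>q \<approx> n / m\<close> variables, chaining Fourier matrices gives an
  \<open>m\<close>-linear form with \<open>q\<^sup>m\<close> unimodular coefficients and supremum at most \<open>q\<^bsup>(m+1)/2\<^esup>\<close>.
\<close>

section \<open>Averages over roots of unity\<close>

text \<open>Parseval for an abstract orthogonal system: expand the square, and the off-diagonal
  terms vanish. It is kept abstract because it serves both monomials on grids of roots of unity and
  the Fourier matrices of the upper bound.\<close>

lemma sum_norm_squared_orthogonal:
  fixes e :: "'i \<Rightarrow> 'x \<Rightarrow> complex" and b :: "'i \<Rightarrow> complex"
  assumes "finite A"
    and orth: "\<And>i j. i \<in> A \<Longrightarrow> j \<in> A \<Longrightarrow>
      (\<Sum>x\<in>X. e i x * cnj (e j x)) = (if i = j then of_real K else 0)"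
  shows "(\<Sum>x\<in>X. (cmod (\<Sum>i\<in>A. b i * e i x))\<^sup>2) = K * (\<Sum>i\<in>A. (cmod (b i))\<^sup>2)"
proof -
  have "complex_of_real (\<Sum>x\<in>X. (cmod (\<Sum>i\<in>A. b i * e i x))\<^sup>2)
      = (\<Sum>x\<in>X. \<Sum>i\<in>A. \<Sum>j\<in>A. (b i * cnj (b j)) * (e i x * cnj (e j x)))"
    by (simp add: complex_norm_square sum_product mult_ac del: of_real_power)
  also have "\<dots> = (\<Sum>i\<in>A. \<Sum>j\<in>A. (b i * cnj (b j)) * (\<Sum>x\<in>X. e i x * cnj (e j x)))"
    by (subst sum.swap, rule sum.cong, simp, subst sum.swap) (simp add: sum_distrib_left)
  also have "\<dots> = (\<Sum>i\<in>A. \<Sum>j\<in>A. if i = j then (b i * cnj (b j)) * of_real K else 0)"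
    by (intro sum.cong refl) (simp add: orth)
  also have "\<dots> = (\<Sum>i\<in>A. (b i * cnj (b i)) * of_real K)"
    using \<open>finite A\<close> by (simp add: sum.delta)
  also have "\<dots> = complex_of_real (K * (\<Sum>i\<in>A. (cmod (b i))\<^sup>2))"
    by (simp add: complex_norm_square sum_distrib_left mult_ac del: of_real_power)
  finally show ?thesis
    using of_real_eq_iff by blast
qed

definition unity_root :: "nat \<Rightarrow> nat \<Rightarrow> complex" where
  "unity_root N k = cis (2 * pi * real k / real N)"

lemma norm_unity_root [simp]: "cmod (unity_root N k) = 1"
  by (simp add: unity_root_def)

text \<open>A geometric sum whose ratio \<open>x\<close> is an N-th root of unity. For distinct
  exponents below \<open>N\<close> the ratio is not 1, so the sum vanishes.\<close>

lemma unity_root_orthogonal: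
  assumes "a < N" "b < N"
  shows "(\<Sum>k<N. unity_root N k ^ a * cnj (unity_root N k ^ b))
    = (if a = b then of_real (real N) else 0)"
proof -
  define x where "x = unity_root N a * cnj (unity_root N b)"
  have "N > 0" using assms by simp
  have pow: "unity_root N k ^ a = unity_root N a ^ k" for k a
    by (simp add: unity_root_def Complex.DeMoivre mult_ac)
  have x: "unity_root N k ^ a * cnj (unity_root N k ^ b) = x ^ k" for k
    by (simp only: pow x_def power_mult_distrib complex_cnj_power)
  show ?thesis
  proof (cases "a = b")
    case True
    hence "x = 1" by (simp add: x_def complex_norm_square[symmetric])
    thus ?thesis using True unfolding x by simp
  next
    case False
    have "unity_root N a \<noteq> unity_root N b"
      using Complex.bij_betw_roots_unity[OF \<open>N > 0\<close>] assms False
      unfolding bij_betw_def inj_on_def unity_root_def by (auto simp: mult_ac)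
    moreover have "unity_root N b * x = unity_root N a"
      unfolding x_def by (simp add: complex_norm_square[symmetric] mult.left_commute)
    ultimately have "x \<noteq> 1" by auto
    have one: "unity_root N k ^ N = 1" for k
      using \<open>N > 0\<close> by (simp add: unity_root_def Complex.DeMoivre cis_multiple_2pi)
    have "x ^ N = 1"
      by (simp add: x_def power_mult_distrib one flip: complex_cnj_power)
    have "(\<Sum>k<N. x ^ k) = 0"
      using geometric_sum[OF \<open>x \<noteq> 1\<close>, of N] \<open>x ^ N = 1\<close> by simp
    thus ?thesis using False unfolding x by simp
  qed
qed

lemma unimodular_rotation_exists: "\<exists>u. cmod u = 1 \<and> u * x = of_real (cmod x)"
proof (cases "x = 0")
  case False
  hence "cmod (cnj (sgn x)) = 1 \<and> cnj (sgn x) * x = of_real (cmod x)"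
    by (simp add: norm_sgn sgn_eq complex_norm_square[symmetric] power2_eq_square mult.commute
        norm_divide field_simps flip: of_real_mult)
  thus ?thesis by blast
qed (auto intro: exI[of _ 1])

text \<open>Testing against the nonnegative kernel \<open>1 + Re (u w\<^sup>-\<^sup>m)\<close>, which has mean one.\<close>
lemma bounded_polynomial_coeff_bound:
  fixes a :: "nat \<Rightarrow> complex"
  assumes bd: "\<And>w. cmod w = 1 \<Longrightarrow> cmod (\<Sum>k\<le>M. a k * w ^ k) \<le> R"
    and m: "0 < m" "m \<le> M"
  shows "cmod (a m) \<le> 2 * (R - cmod (a 0))"
proof -
  \<comment> \<open>All exponents \<open>j + m\<close> met below are at most \<open>2 * M\<close>,
    so \<open>N\<close> points separate them; averaging \<open>F\<close> against \<open>W\<close>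
    then leaves only \<open>a 0\<close> and half of \<open>u * a m\<close>.\<close>
  define N where "N = 2 * M + 1"
  have N: "0 < N" "m < N" "\<And>j. j \<le> M \<Longrightarrow> j < N" "\<And>j. j \<le> M \<Longrightarrow> j + m < N"
    using m by (auto simp: N_def)
  obtain v0 where v0: "cmod v0 = 1" "v0 * a 0 = of_real (cmod (a 0))"
    using unimodular_rotation_exists by blast
  obtain vm where vm: "cmod vm = 1" "vm * a m = of_real (cmod (a m))"
    using unimodular_rotation_exists by blast
  \<comment> \<open>This rotation gives \<open>u * a m\<close> the same argument as
    \<open>a 0\<close>, so the modulus of \<open>a 0 + u / 2 * a m\<close> is the sum of the
    moduli.\<close>
  define u where "u = vm * cnj v0"
  have u: "cmod u = 1" by (simp add: u_def norm_mult v0 vm)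
  define z where "z = unity_root N"
  define F where "F w = (\<Sum>k\<le>M. a k * w ^ k)" for w
  define W where "W k = 1 + Re (u * cnj (z k ^ m))" for k
  have orth: "(\<Sum>k<N. z k ^ i * cnj (z k ^ j)) = (if i = j then of_real (real N) else 0)"
    if "i < N" "j < N" for i j
    using unity_root_orthogonal[OF that] by (simp add: z_def)
  have orth0: "(\<Sum>k<N. z k ^ i) = (if i = 0 then of_real (real N) else 0)" if "i < N" for i
    using orth[OF that, of 0] N by simp
  have W0: "W k \<ge> 0" for k
    using abs_Re_le_cmod[of "u * cnj (z k ^ m)"]
    by (simp add: W_def norm_mult norm_power u z_def)
  have Wc: "complex_of_real (W k) = 1 + (u * cnj (z k ^ m) + cnj u * z k ^ m) / 2" for k
    unfolding W_def by (simp add: complex_eq_iff del: complex_cnj_power)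
  have sumW: "(\<Sum>k<N. W k) = real N"
  proof -
    have "complex_of_real (\<Sum>k<N. W k) = (\<Sum>k<N. 1 + (u/2) * (z k ^ 0 * cnj (z k ^ m)) + (cnj u/2) * z k ^ m)"
      by (simp add: Wc add_divide_distrib add.assoc)
    also have "\<dots> = of_nat N + (u/2) * (\<Sum>k<N. z k ^ 0 * cnj (z k ^ m)) + (cnj u/2) * (\<Sum>k<N. z k ^ m)"
      by (simp only: sum.distrib sum_distrib_left) simp
    also have "\<dots> = complex_of_real (real N)"
      using m N by (simp only: orth orth0) simp
    finally show ?thesis using of_real_eq_iff by blast
  qed
  have "(\<Sum>k<N. F (z k) * of_real (W k))
     = (\<Sum>k<N. \<Sum>j\<le>M. a j * (z k ^ j + (u/2) * (z k ^ j * cnj (z k ^ m)) + (cnj u/2) * z k ^ (j + m)))"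
    unfolding F_def Wc sum_distrib_right
    by (intro sum.cong refl) (simp add: power_add field_simps)
  also have "\<dots> = (\<Sum>j\<le>M. a j * ((\<Sum>k<N. z k ^ j) + (u/2) * (\<Sum>k<N. z k ^ j * cnj (z k ^ m)) + (cnj u/2) * (\<Sum>k<N. z k ^ (j + m))))"
    by (subst sum.swap) (simp only: sum.distrib sum_distrib_left distrib_left)
  also have "\<dots> = (\<Sum>j\<le>M. (if j = 0 then a j * of_nat N else 0) + (if j = m then a j * (u / 2) * of_nat N else 0))"
    using m N by (intro sum.cong refl, subst orth) (auto simp: orth0)
  also have "\<dots> = of_nat N * (a 0 + u / 2 * a m)"
    using m by (simp add: sum.distrib sum.delta' algebra_simps)
  finally have eq: "(\<Sum>k<N. F (z k) * of_real (W k)) = of_nat N * (a 0 + u / 2 * a m)" .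
  have "cmod (\<Sum>k<N. F (z k) * of_real (W k)) \<le> (\<Sum>k<N. R * W k)"
    using W0 bd by (intro sum_norm_le) (auto simp: norm_mult F_def z_def intro!: mult_right_mono)
  also have "\<dots> = real N * R" by (simp add: sumW flip: sum_distrib_left)
  finally have "cmod (a 0 + u / 2 * a m) \<le> R"
    unfolding eq norm_mult using N by simp
  moreover have "v0 * (a 0 + u / 2 * a m) = of_real (cmod (a 0) + cmod (a m) / 2)"
  proof -
    have "v0 * (u / 2 * a m) = (v0 * cnj v0) * (vm * a m) / 2"
      by (simp add: u_def)
    also have "\<dots> = of_real (cmod (a m) / 2)"
      using v0(1) by (simp add: vm flip: complex_norm_square)
    finally show ?thesis by (simp add: distrib_left v0)
  qed
  hence "cmod (a 0 + u / 2 * a m) = cmod (a 0) + cmod (a m) / 2"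
    by (metis abs_of_nonneg add_nonneg_nonneg divide_nonneg_nonneg mult_1 norm_ge_zero norm_mult
        norm_of_real v0(1) zero_le_numeral)
  ultimately show ?thesis by simp
qed

section \<open>Multi-indices and homogeneous polynomials\<close>

definition homogeneous_indices :: "nat \<Rightarrow> nat \<Rightarrow> (nat \<Rightarrow> nat) set" where
  "homogeneous_indices n m = {\<alpha> \<in> multi_indices n. (\<Sum>i<n. \<alpha> i) = m}"

lemma multi_indices_eqI:
  assumes "\<alpha> \<in> multi_indices n" "\<beta> \<in> multi_indices n" "\<And>i. i < n \<Longrightarrow> \<alpha> i = \<beta> i"
  shows "\<alpha> = \<beta>"
proof
  fix i show "\<alpha> i = \<beta> i"
    using assms by (cases "i < n") (auto simp: multi_indices_def)
qed

text \<open>Restriction carries multi-indices into \<open>PiE\<close>, where cardinalities and sums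
  of products factor over the coordinates.\<close>

lemma inj_on_restrict_multi_indices: "inj_on (\<lambda>\<alpha>. restrict \<alpha> {..<n}) (multi_indices n)"
proof (rule inj_onI)
  fix \<alpha> \<beta> assume "\<alpha> \<in> multi_indices n" "\<beta> \<in> multi_indices n"
    and eq: "restrict \<alpha> {..<n} = restrict \<beta> {..<n}"
  thus "\<alpha> = \<beta>"
    by (intro multi_indices_eqI[of _ n]) (auto dest: fun_cong simp: restrict_def, metis)
qed

lemma homogeneous_indices_le:
  assumes "\<alpha> \<in> homogeneous_indices n m"
  shows "\<alpha> i \<le> m"
proof (cases "i < n")
  case True
  thus ?thesis using assms member_le_sum[of i "{..<n}" \<alpha>] by (auto simp: homogeneous_indices_def)
next
  case False
  thus ?thesis using assms by (auto simp: homogeneous_indices_def multi_indices_def)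
qed

lemma finite_multi_indices_below:
  fixes n :: nat and \<gamma> :: "nat \<Rightarrow> nat"
  defines "S \<equiv> {\<alpha> \<in> multi_indices n. \<forall>i<n. \<alpha> i \<le> \<gamma> i}"
  shows "finite S" and "card S \<le> (\<Prod>i<n. \<gamma> i + 1)"
proof -
  have inj: "inj_on (\<lambda>\<alpha>. restrict \<alpha> {..<n}) S"
    using inj_on_restrict_multi_indices by (rule inj_on_subset) (auto simp: S_def)
  have sub: "(\<lambda>\<alpha>. restrict \<alpha> {..<n}) ` S \<subseteq> PiE {..<n} (\<lambda>i. {..\<gamma> i})"
    by (auto simp: S_def split: if_splits)
  have fin: "finite (PiE {..<n} (\<lambda>i. {..\<gamma> i}))"
    by (intro finite_PiE) auto
  show "finite S"
    using inj_on_finite[OF inj sub fin] .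
  show "card S \<le> (\<Prod>i<n. \<gamma> i + 1)"
    using card_inj_on_le[OF inj sub fin] by (simp add: card_PiE)
qed

lemma finite_homogeneous_indices [simp]: "finite (homogeneous_indices n m)"
  by (rule finite_subset[OF _ finite_multi_indices_below(1)[of n "\<lambda>_. m"]])
    (auto simp: homogeneous_indices_le, auto simp: homogeneous_indices_def)

lemma homogeneous_indices_0: "homogeneous_indices n 0 = {\<lambda>_. 0}"
proof (intro equalityI subsetI)
  fix \<alpha> assume a: "\<alpha> \<in> homogeneous_indices n 0"
  have "\<alpha> = (\<lambda>_. 0)" using homogeneous_indices_le[OF a] by auto
  thus "\<alpha> \<in> {\<lambda>_. 0}" by simp
qed (auto simp: homogeneous_indices_def multi_indices_def)

text \<open>The generating function \<open>\<Sum>\<^sub>m |I\<^sub>m| x\<^sup>m = (1 - x)\<^sup>-\<^sup>n\<close> evaluated at \<open>x = m / (m + n)\<close>.\<close>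
lemma card_homogeneous_indices_le:
  assumes "m > 0" "n > 0"
  shows "real (card (homogeneous_indices n m)) \<le> exp (real m) * (1 + real n / real m) ^ m"
proof -
  define x :: real where "x = real m / (real m + real n)"
  have x: "0 < x" "x < 1" using assms by (auto simp: x_def)
  let ?r = "\<lambda>\<alpha>::nat\<Rightarrow>nat. restrict \<alpha> {..<n}"
  have inj: "inj_on ?r (homogeneous_indices n m)"
    using inj_on_restrict_multi_indices by (rule inj_on_subset) (auto simp: homogeneous_indices_def)
  have "real (card (homogeneous_indices n m)) * x ^ m = (\<Sum>\<alpha>\<in>homogeneous_indices n m. \<Prod>i<n. x ^ ?r \<alpha> i)"
    by (simp add: homogeneous_indices_def flip: power_sum)
  also have "\<dots> = (\<Sum>\<beta>\<in>?r ` homogeneous_indices n m. \<Prod>i<n. x ^ \<beta> i)"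
    using inj by (simp add: sum.reindex)
  \<comment> \<open>Dropping the degree condition makes the sum a product of \<open>n\<close>
    truncated geometric series.\<close>
  also have "\<dots> \<le> (\<Sum>\<beta>\<in>PiE {..<n} (\<lambda>_. {..m}). \<Prod>i<n. x ^ \<beta> i)"
    using x by (intro sum_mono2 finite_PiE prod_nonneg) (auto simp: homogeneous_indices_le split: if_splits)
  also have "\<dots> = (\<Prod>i<n. \<Sum>k\<le>m. x ^ k)"
    by (subst prod_sum_PiE) auto
  also have "\<dots> \<le> (\<Prod>i<n. 1 / (1 - x))"
  proof (intro prod_mono conjI)
    fix i
    show "0 \<le> (\<Sum>k\<le>m. x ^ k)" using x by (intro sum_nonneg) auto
    have "(\<Sum>k\<le>m. x ^ k) = (1 - x ^ Suc m) / (1 - x)"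
      using x by (subst sum_gp0) auto
    also have "\<dots> \<le> 1 / (1 - x)" using x by (intro divide_right_mono) auto
    finally show "(\<Sum>k\<le>m. x ^ k) \<le> 1 / (1 - x)" .
  qed
  also have "\<dots> = (1 + real m / real n) ^ n"
    using assms by (simp add: x_def field_simps)
  also have "\<dots> \<le> exp (real m)"
    using exp_ge_one_plus_x_over_n_power_n[of n "real m"] assms by simp
  finally have "real (card (homogeneous_indices n m)) \<le> exp (real m) / x ^ m"
    using x by (simp add: field_simps)
  also have "\<dots> = exp (real m) * (1 + real n / real m) ^ m"
    using assms by (simp add: x_def field_simps power_divide)
  finally show ?thesis .
qed

section \<open>Parseval and moment estimates on grids of roots of unity\<close>

definition grid :: "nat \<Rightarrow> nat \<Rightarrow> (nat \<Rightarrow> nat) set" where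
  "grid n N = PiE {..<n} (\<lambda>_. {..<N})"

definition grid_point :: "nat \<Rightarrow> (nat \<Rightarrow> nat) \<Rightarrow> nat \<Rightarrow> complex" where
  "grid_point N \<theta> i = unity_root N (\<theta> i)"

lemma finite_grid [simp]: "finite (grid n N)"
  by (simp add: grid_def finite_PiE)

lemma card_grid [simp]: "card (grid n N) = N ^ n"
  by (simp add: grid_def card_PiE)

lemma norm_grid_point [simp]: "cmod (grid_point N \<theta> i) = 1"
  by (simp add: grid_point_def)

text \<open>The sum factors over the coordinates. Exponents below \<open>N\<close> rule out
  aliasing, so the grid average of such a product agrees with its integral over the torus.\<close>

lemma monom_orthogonal:
  assumes "\<alpha> \<in> multi_indices n" "\<beta> \<in> multi_indices n"
    and "\<And>i. i < n \<Longrightarrow> \<alpha> i < N" "\<And>i. i < n \<Longrightarrow> \<beta> i < N"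
  shows "(\<Sum>\<theta>\<in>grid n N. monom n (grid_point N \<theta>) \<alpha> * cnj (monom n (grid_point N \<theta>) \<beta>))
    = (if \<alpha> = \<beta> then of_real (real N ^ n) else 0)"
proof -
  have "(\<Sum>\<theta>\<in>grid n N. monom n (grid_point N \<theta>) \<alpha> * cnj (monom n (grid_point N \<theta>) \<beta>))
     = (\<Sum>\<theta>\<in>grid n N. \<Prod>i<n. unity_root N (\<theta> i) ^ \<alpha> i * cnj (unity_root N (\<theta> i) ^ \<beta> i))"
    by (simp add: monom_def grid_point_def prod.distrib)
  also have "\<dots> = (\<Prod>i<n. \<Sum>k<N. unity_root N k ^ \<alpha> i * cnj (unity_root N k ^ \<beta> i))"
    unfolding grid_def by (subst prod_sum_PiE) auto
  also have "\<dots> = (\<Prod>i<n. if \<alpha> i = \<beta> i then of_real (real N) else 0)"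
    using assms by (intro prod.cong refl unity_root_orthogonal) auto
  also have "\<dots> = (if \<alpha> = \<beta> then of_real (real N ^ n) else 0)"
  proof (cases "\<alpha> = \<beta>")
    case False
    then obtain i where "i < n" "\<alpha> i \<noteq> \<beta> i"
      using multi_indices_eqI[OF assms(1,2)] by blast
    thus ?thesis using False by (simp add: prod_zero_iff) blast
  qed simp
  finally show ?thesis .
qed

lemma grid_parseval:
  assumes "finite A" "A \<subseteq> multi_indices n" "\<And>\<alpha> i. \<alpha> \<in> A \<Longrightarrow> i < n \<Longrightarrow> \<alpha> i < N"
  shows "(\<Sum>\<theta>\<in>grid n N. (cmod (\<Sum>\<alpha>\<in>A. b \<alpha> * monom n (grid_point N \<theta>) \<alpha>))\<^sup>2)
    = real N ^ n * (\<Sum>\<alpha>\<in>A. (cmod (b \<alpha>))\<^sup>2)"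
  using assms by (intro sum_norm_squared_orthogonal monom_orthogonal) auto

lemma monom_add: "monom n z (\<lambda>i. \<alpha> i + \<beta> i) = monom n z \<alpha> * monom n z \<beta>"
  by (simp add: monom_def power_add prod.distrib)

text \<open>Each index of degree \<open>2 m\<close> splits into two indices in at most
  \<open>\<Prod>\<^sub>i (\<gamma>\<^sub>i + 1) \<le> 2\<^sup>2\<^sup>m\<close> ways.\<close>
lemma homogeneous_fourth_moment:
  fixes n m N :: nat and b :: "(nat \<Rightarrow> nat) \<Rightarrow> complex"
  assumes N: "N > 2 * m"
  defines "I \<equiv> homogeneous_indices n m"
  defines "g \<equiv> \<lambda>\<theta>. \<Sum>\<alpha>\<in>I. b \<alpha> * monom n (grid_point N \<theta>) \<alpha>"
  shows "(\<Sum>\<theta>\<in>grid n N. cmod (g \<theta>) ^ 4) \<le> real N ^ n * (4 ^ m * (\<Sum>\<alpha>\<in>I. (cmod (b \<alpha>))\<^sup>2)\<^sup>2)"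
proof -
  define J where "J = homogeneous_indices n (2 * m)"
  define pl :: "(nat \<Rightarrow> nat) \<times> (nat \<Rightarrow> nat) \<Rightarrow> nat \<Rightarrow> nat" where "pl = (\<lambda>(\<alpha>, \<beta>) i. \<alpha> i + \<beta> i)"
  define Q where "Q \<gamma> = {x \<in> I \<times> I. pl x = \<gamma>}" for \<gamma>
  \<comment> \<open>These are the coefficients of \<open>g^2\<close>, whose exponents are at most
    \<open>2 * m < N\<close>; Parseval for \<open>g^2\<close> then expresses the fourth moment of
    \<open>g\<close>.\<close>
  define d where "d \<gamma> = (\<Sum>x\<in>Q \<gamma>. b (fst x) * b (snd x))" for \<gamma>
  have fin [simp]: "finite I" "finite J" by (simp_all add: I_def J_def)
  have pl: "pl ` (I \<times> I) \<subseteq> J"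
    by (auto simp: pl_def I_def J_def homogeneous_indices_def multi_indices_def sum.distrib)
  have sq: "g \<theta> ^ 2 = (\<Sum>\<gamma>\<in>J. d \<gamma> * monom n (grid_point N \<theta>) \<gamma>)" for \<theta>
  proof -
    have "g \<theta> ^ 2 = (\<Sum>x\<in>I\<times>I. b (fst x) * b (snd x) * monom n (grid_point N \<theta>) (pl x))"
      unfolding g_def power2_eq_square sum_product sum.cartesian_product
      by (intro sum.cong) (auto simp: pl_def monom_add)
    also have "\<dots> = (\<Sum>\<gamma>\<in>J. \<Sum>x\<in>Q \<gamma>. b (fst x) * b (snd x) * monom n (grid_point N \<theta>) (pl x))"
      unfolding Q_def using pl by (intro sum.group[symmetric]) auto
    also have "\<dots> = (\<Sum>\<gamma>\<in>J. d \<gamma> * monom n (grid_point N \<theta>) \<gamma>)"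
      unfolding d_def sum_distrib_right by (intro sum.cong refl) (auto simp: Q_def)
    finally show ?thesis .
  qed
  have card: "real (card (Q \<gamma>)) \<le> 4 ^ m" if "\<gamma> \<in> J" for \<gamma>
  proof -
    have "inj_on fst (Q \<gamma>)"
    proof (rule inj_onI)
      fix x y assume "x \<in> Q \<gamma>" "y \<in> Q \<gamma>" "fst x = fst y"
      hence "snd x i = snd y i" for i
        by (auto simp: Q_def pl_def dest!: fun_cong[where x = i])
      thus "x = y" using \<open>fst x = fst y\<close> by (intro prod_eqI) auto
    qed
    moreover have "fst ` Q \<gamma> \<subseteq> {\<alpha> \<in> multi_indices n. \<forall>i<n. \<alpha> i \<le> \<gamma> i}"
      by (auto simp: Q_def I_def homogeneous_indices_def pl_def)
    ultimately have "card (Q \<gamma>) \<le> card {\<alpha> \<in> multi_indices n. \<forall>i<n. \<alpha> i \<le> \<gamma> i}"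
      using finite_multi_indices_below(1) by (rule card_inj_on_le)
    also have "\<dots> \<le> (\<Prod>i<n. \<gamma> i + 1)" by (rule finite_multi_indices_below)
    also have "\<dots> \<le> (\<Prod>i<n. 2 ^ \<gamma> i)"
      by (intro prod_mono) (auto simp: Suc_leI)
    also have "\<dots> = 2 ^ (2 * m)"
      using that by (simp add: J_def homogeneous_indices_def flip: power_sum)
    also have "\<dots> = 4 ^ m" by (simp add: power_mult)
    finally show ?thesis by (metis of_nat_le_iff of_nat_numeral of_nat_power)
  qed
  \<comment> \<open>Cauchy-Schwarz over the splittings of \<open>\<gamma>\<close>; their number is
    the whole loss.\<close>
  have d: "(cmod (d \<gamma>))\<^sup>2 \<le> 4 ^ m * (\<Sum>x\<in>Q \<gamma>. (cmod (b (fst x)))\<^sup>2 * (cmod (b (snd x)))\<^sup>2)"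
    if "\<gamma> \<in> J" for \<gamma>
  proof -
    have "(cmod (d \<gamma>))\<^sup>2 \<le> (\<Sum>x\<in>Q \<gamma>. 1 * cmod (b (fst x) * b (snd x)))\<^sup>2"
      unfolding d_def by (intro power_mono) (auto intro: norm_sum)
    also have "\<dots> \<le> (\<Sum>x\<in>Q \<gamma>. 1\<^sup>2) * (\<Sum>x\<in>Q \<gamma>. (cmod (b (fst x) * b (snd x)))\<^sup>2)"
      by (rule Cauchy_Schwarz_ineq_sum)
    also have "\<dots> \<le> 4 ^ m * (\<Sum>x\<in>Q \<gamma>. (cmod (b (fst x)))\<^sup>2 * (cmod (b (snd x)))\<^sup>2)"
      using card[OF that] by (auto intro!: mult_mono sum_nonneg simp: norm_mult power_mult_distrib)
    finally show ?thesis .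
  qed
  have "(\<Sum>\<theta>\<in>grid n N. cmod (g \<theta>) ^ 4) = (\<Sum>\<theta>\<in>grid n N. (cmod (g \<theta> ^ 2))\<^sup>2)"
    by (simp add: norm_power flip: power_mult)
  also have "\<dots> = real N ^ n * (\<Sum>\<gamma>\<in>J. (cmod (d \<gamma>))\<^sup>2)"
    unfolding sq using N
    by (intro grid_parseval) (auto simp: J_def intro: le_less_trans[OF homogeneous_indices_le],
        auto simp: homogeneous_indices_def)
  also have "\<dots> \<le> real N ^ n * (\<Sum>\<gamma>\<in>J. 4 ^ m * (\<Sum>x\<in>Q \<gamma>. (cmod (b (fst x)))\<^sup>2 * (cmod (b (snd x)))\<^sup>2))"
    by (intro mult_left_mono sum_mono d) auto
  also have "\<dots> = real N ^ n * (4 ^ m * (\<Sum>\<gamma>\<in>J. \<Sum>x\<in>Q \<gamma>. (cmod (b (fst x)))\<^sup>2 * (cmod (b (snd x)))\<^sup>2))"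
    by (simp only: sum_distrib_left)
  also have "(\<Sum>\<gamma>\<in>J. \<Sum>x\<in>Q \<gamma>. (cmod (b (fst x)))\<^sup>2 * (cmod (b (snd x)))\<^sup>2)
      = (\<Sum>x\<in>I\<times>I. (cmod (b (fst x)))\<^sup>2 * (cmod (b (snd x)))\<^sup>2)"
    unfolding Q_def using pl by (intro sum.group) auto
  also have "\<dots> = (\<Sum>\<alpha>\<in>I. (cmod (b \<alpha>))\<^sup>2)\<^sup>2"
    unfolding power2_eq_square sum_product sum.cartesian_product by (simp add: case_prod_unfold)
  finally show ?thesis .
qed

text \<open>The \<open>L\<^sup>1\<close>--\<open>L\<^sup>2\<close> comparison comes from integrating the pointwise inequality
  \<open>y \<ge> y\<^sup>2 - y\<^sup>4\<close> for a suitable multiple \<open>y\<close> of \<open>|g|\<close>.\<close>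
lemma homogeneous_L2_le_L1:
  fixes n m N :: nat and b :: "(nat \<Rightarrow> nat) \<Rightarrow> complex"
  assumes N: "N > 2 * m"
  defines "I \<equiv> homogeneous_indices n m"
  defines "g \<equiv> \<lambda>\<theta>. \<Sum>\<alpha>\<in>I. b \<alpha> * monom n (grid_point N \<theta>) \<alpha>"
  shows "real N ^ n * sqrt (\<Sum>\<alpha>\<in>I. (cmod (b \<alpha>))\<^sup>2) \<le> 3 * 2 ^ m * (\<Sum>\<theta>\<in>grid n N. cmod (g \<theta>))"
proof -
  define s where "s = (\<Sum>\<alpha>\<in>I. (cmod (b \<alpha>))\<^sup>2)"
  define K where "K = real N ^ n"
  define E where "E = (\<Sum>\<theta>\<in>grid n N. cmod (g \<theta>))"
  have "s \<ge> 0" by (simp add: s_def sum_nonneg)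
  have "K > 0" using N by (simp add: K_def)
  have "K * sqrt s \<le> 3 * 2 ^ m * E"
  proof (cases "s = 0")
    case True
    thus ?thesis by (simp add: E_def sum_nonneg)
  next
    case False
    hence "s > 0" using \<open>s \<ge> 0\<close> by simp
    \<comment> \<open>With this scale the quartic term of the integrated inequality is exactly half
      of the quadratic one.\<close>
    define \<tau> where "\<tau> = 2 ^ m * sqrt (2 * s)"
    have \<tau>: "\<tau> > 0" "\<tau>\<^sup>2 = 2 * 4 ^ m * s"
      using \<open>s > 0\<close> by (simp_all add: \<tau>_def power_mult_distrib power_even_eq[symmetric] power_mult)
    have m2: "(\<Sum>\<theta>\<in>grid n N. (cmod (g \<theta>))\<^sup>2) = K * s"
      unfolding g_def s_def K_def using N
      by (intro grid_parseval) (auto simp: I_def intro: le_less_trans[OF homogeneous_indices_le],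
        auto simp: homogeneous_indices_def)
    have m4: "(\<Sum>\<theta>\<in>grid n N. cmod (g \<theta>) ^ 4) \<le> K * (4 ^ m * s\<^sup>2)"
      unfolding g_def s_def K_def I_def by (rule homogeneous_fourth_moment[OF N])
    have pt: "y \<ge> y\<^sup>2 - y ^ 4" if "y \<ge> 0" for y :: real
    proof (cases "y \<le> 1")
      case True
      hence "y\<^sup>2 \<le> y" using that by (simp add: power2_eq_square mult_left_le)
      thus ?thesis using that by (smt (verit) zero_le_power)
    next
      case False
      hence "y\<^sup>2 \<le> y ^ 4" by (intro power_increasing) auto
      thus ?thesis using that by linarith
    qed
    have "K * s / \<tau>\<^sup>2 - K * (4 ^ m * s\<^sup>2) / \<tau> ^ 4
       \<le> (\<Sum>\<theta>\<in>grid n N. (cmod (g \<theta>))\<^sup>2) / \<tau>\<^sup>2 - (\<Sum>\<theta>\<in>grid n N. cmod (g \<theta>) ^ 4) / \<tau> ^ 4"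
      unfolding m2 using m4 by (intro diff_left_mono divide_right_mono) auto
    also have "\<dots> = (\<Sum>\<theta>\<in>grid n N. (cmod (g \<theta>) / \<tau>)\<^sup>2 - (cmod (g \<theta>) / \<tau>) ^ 4)"
      by (simp only: sum_subtractf sum_divide_distrib power_divide)
    also have "\<dots> \<le> (\<Sum>\<theta>\<in>grid n N. cmod (g \<theta>) / \<tau>)"
      using \<tau> by (intro sum_mono pt) auto
    also have "\<dots> = E / \<tau>" by (simp add: E_def sum_divide_distrib)
    also have "K * s / \<tau>\<^sup>2 - K * (4 ^ m * s\<^sup>2) / \<tau> ^ 4 = K * s / (2 * \<tau>\<^sup>2)"
    proof -
      have "\<tau> ^ 4 = \<tau>\<^sup>2 * (2 * 4 ^ m * s)"
        by (metis \<tau>(2) power2_eq_square power4_eq_xxxx mult.assoc)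
      thus ?thesis using \<open>s > 0\<close> \<tau>(1) by (simp add: field_simps power2_eq_square)
    qed
    finally have "K * s \<le> 2 * \<tau> * E"
      using \<tau>(1) by (simp add: field_simps power2_eq_square)
    also have "\<dots> = sqrt s * (2 * sqrt 2 * 2 ^ m * E)"
      by (simp add: \<tau>_def real_sqrt_mult)
    finally have "sqrt s * (K * sqrt s) \<le> sqrt s * (2 * sqrt 2 * 2 ^ m * E)"
      using \<open>s > 0\<close> by (simp add: algebra_simps)
    hence "K * sqrt s \<le> 2 * sqrt 2 * (2 ^ m * E)"
      using \<open>s > 0\<close> by (simp add: mult.assoc)
    also have "\<dots> \<le> 3 * (2 ^ m * E)"
    proof (rule mult_right_mono)
      have "sqrt 2 \<le> 3 / 2" by (rule real_le_lsqrt) (auto simp: power2_eq_square)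
      thus "2 * sqrt 2 \<le> 3" by simp
    qed (simp add: E_def sum_nonneg)
    finally show ?thesis by simp
  qed
  thus ?thesis unfolding K_def s_def E_def .
qed

section \<open>Coefficient sums of bounded homogeneous polynomials\<close>

text \<open>The closed polydisk is used so that grid points qualify; coordinates from
  \<open>n\<close> on are left free because \<open>monom\<close> does not read them and grid points
  need not vanish there.\<close>

definition bounded_on_polydisk :: "nat \<Rightarrow> nat \<Rightarrow> ((nat \<Rightarrow> nat) \<Rightarrow> complex) \<Rightarrow> real \<Rightarrow> bool" where
  "bounded_on_polydisk n m c B \<longleftrightarrow> (\<forall>z. (\<forall>i<n. cmod (z i) \<le> 1) \<longrightarrow>
     cmod (\<Sum>\<alpha>\<in>homogeneous_indices n m. c \<alpha> * monom n z \<alpha>) \<le> B)"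

lemma monom_scale:
  assumes "\<alpha> \<in> homogeneous_indices n m"
  shows "monom n (\<lambda>i. t * z i) \<alpha> = t ^ m * monom n z \<alpha>"
  using assms by (simp add: monom_def power_mult_distrib prod.distrib homogeneous_indices_def
      flip: power_sum)

lemma has_field_derivative_prod_one_plus:
  fixes u :: "nat \<Rightarrow> complex"
  shows "((\<lambda>t. \<Prod>i<n. (1 + t * u i) ^ \<alpha> i) has_field_derivative (\<Sum>i<n. of_nat (\<alpha> i) * u i)) (at 0)"
proof -
  have "((\<lambda>t. \<Prod>i<n. (1 + t * u i) ^ \<alpha> i) has_field_derivative
    (\<Prod>i<n. (1 + 0 * u i) ^ \<alpha> i) * (\<Sum>i<n. (of_nat (\<alpha> i) * u i) / (1 + 0 * u i) ^ \<alpha> i)) (at 0)"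
    by (rule has_field_derivative_prod') (auto intro!: derivative_eq_intros)
  thus ?thesis by simp
qed

text \<open>For unimodular \<open>u\<close>, the sum \<open>\<Sum>\<^sub>j u\<^sub>j z\<^sub>j \<partial>\<^sub>jP(z)\<close> is the derivative at \<open>t = 0\<close> of
  \<open>P(z (1 + t u))\<close>, which Cauchy's inequality on \<open>|t| = 1/m\<close> controls.\<close>
lemma sum_euler_derivatives_le:
  assumes bd: "bounded_on_polydisk n m c B" and m: "m > 0"
    and z: "\<And>i. i < n \<Longrightarrow> cmod (z i) \<le> 1"
  shows "(\<Sum>j<n. cmod (\<Sum>\<alpha>\<in>homogeneous_indices n m. of_nat (\<alpha> j) * c \<alpha> * monom n z \<alpha>)) \<le> exp 1 * real m * B"
proof -
  define I where "I = homogeneous_indices n m"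
  define R where "R j = (\<Sum>\<alpha>\<in>I. of_nat (\<alpha> j) * c \<alpha> * monom n z \<alpha>)" for j
  have "\<forall>j. \<exists>u. cmod u = 1 \<and> u * R j = of_real (cmod (R j))"
    using unimodular_rotation_exists by blast
  from choice[OF this] obtain u
    where u: "\<And>j. cmod (u j) = 1" "\<And>j. u j * R j = of_real (cmod (R j))"
    by blast
  define \<phi> where "\<phi> t = (\<Sum>\<alpha>\<in>I. c \<alpha> * monom n z \<alpha> * (\<Prod>i<n. (1 + t * u i) ^ \<alpha> i))" for t
  have \<phi>_eq: "\<phi> t = (\<Sum>\<alpha>\<in>I. c \<alpha> * monom n (\<lambda>i. z i * (1 + t * u i)) \<alpha>)" for t
    by (simp add: \<phi>_def monom_def power_mult_distrib prod.distrib mult_ac)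
  have der: "(\<phi> has_field_derivative (\<Sum>\<alpha>\<in>I. c \<alpha> * monom n z \<alpha> * (\<Sum>i<n. of_nat (\<alpha> i) * u i))) (at 0)"
    unfolding \<phi>_def by (intro DERIV_sum DERIV_cmult has_field_derivative_prod_one_plus)
  have "(\<Sum>\<alpha>\<in>I. c \<alpha> * monom n z \<alpha> * (\<Sum>i<n. of_nat (\<alpha> i) * u i)) = (\<Sum>j<n. u j * R j)"
    unfolding R_def sum_distrib_left by (subst sum.swap) (simp add: mult_ac)
  also have "\<dots> = of_real (\<Sum>j<n. cmod (R j))" by (simp add: u)
  finally have dval: "deriv \<phi> 0 = of_real (\<Sum>j<n. cmod (R j))"
    using der by (simp add: DERIV_imp_deriv)
  have bound: "cmod (\<phi> t) \<le> exp 1 * B" if t: "cmod t = 1 / real m" for t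
  proof -
    \<comment> \<open>For \<open>|t| = 1/m\<close> the point \<open>z (1 + t u)\<close> lies in the
      polydisk of radius \<open>x\<close>. Scaling it back costs \<open>x ^ m \<le> exp 1\<close> by
      homogeneity.\<close>
    define x where "x = 1 + 1 / real m"
    have "x > 0" using m by (simp add: x_def add_pos_pos)
    define y where "y i = z i * (1 + t * u i) / of_real x" for i
    have y: "cmod (y i) \<le> 1" if "i < n" for i
    proof -
      have "cmod (1 + t * u i) \<le> x"
        using norm_triangle_ineq[of 1 "t * u i"] by (simp add: norm_mult u t x_def)
      hence "cmod (z i) * cmod (1 + t * u i) \<le> 1 * x"
        using z[OF that] by (intro mult_mono) auto
      thus ?thesis using \<open>x > 0\<close> by (simp add: y_def norm_mult norm_divide)
    qed
    have "(\<lambda>i. z i * (1 + t * u i)) = (\<lambda>i. of_real x * y i)"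
      using \<open>x > 0\<close> by (simp add: y_def)
    hence "\<phi> t = of_real x ^ m * (\<Sum>\<alpha>\<in>I. c \<alpha> * monom n y \<alpha>)"
      unfolding \<phi>_eq sum_distrib_left by (intro sum.cong) (auto simp: I_def monom_scale)
    hence "cmod (\<phi> t) = x ^ m * cmod (\<Sum>\<alpha>\<in>I. c \<alpha> * monom n y \<alpha>)"
      using \<open>x > 0\<close> by (simp add: norm_mult norm_power)
    also have "\<dots> \<le> exp 1 * B"
    proof (intro mult_mono)
      show "x ^ m \<le> exp 1"
        using exp_ge_one_plus_x_over_n_power_n[of m 1] m by (simp add: x_def)
      show "cmod (\<Sum>\<alpha>\<in>I. c \<alpha> * monom n y \<alpha>) \<le> B"
        using bd y by (auto simp: bounded_on_polydisk_def I_def)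
    qed auto
    finally show ?thesis .
  qed
  have hol: "\<phi> holomorphic_on UNIV"
    unfolding \<phi>_def by (intro holomorphic_intros)
  have "cmod ((deriv ^^ 1) \<phi> 0) \<le> fact 1 * (exp 1 * B) / (1 / real m) ^ 1"
    using m bound hol
    by (intro Cauchy_inequality) (auto intro: holomorphic_on_subset holomorphic_on_imp_continuous_on continuous_on_subset)
  hence "cmod (deriv \<phi> 0) \<le> exp 1 * real m * B" by (simp add: mult_ac)
  moreover have "cmod (deriv \<phi> 0) = (\<Sum>j<n. cmod (R j))"
    unfolding dval norm_of_real by (simp add: sum_nonneg)
  ultimately show ?thesis by (simp add: R_def I_def)
qed

text \<open>The average of the squared modulus over a grid is at most \<open>B^2\<close>, and
  \<open>m + 1\<close> points per coordinate suffice since exponents are at most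
  \<open>m\<close>.\<close>

lemma homogeneous_parseval_le:
  assumes bd: "bounded_on_polydisk n m c B"
  shows "(\<Sum>\<alpha>\<in>homogeneous_indices n m. (cmod (c \<alpha>))\<^sup>2) \<le> B\<^sup>2"
proof -
  define N where "N = m + 1"
  have "real N ^ n * (\<Sum>\<alpha>\<in>homogeneous_indices n m. (cmod (c \<alpha>))\<^sup>2)
    = (\<Sum>\<theta>\<in>grid n N. (cmod (\<Sum>\<alpha>\<in>homogeneous_indices n m. c \<alpha> * monom n (grid_point N \<theta>) \<alpha>))\<^sup>2)"
    by (rule grid_parseval[symmetric])
      (auto simp: N_def homogeneous_indices_le less_Suc_eq_le, auto simp: homogeneous_indices_def)
  also have "\<dots> \<le> (\<Sum>\<theta>\<in>grid n N. B\<^sup>2)"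
    using bd by (intro sum_mono power_mono) (auto simp: bounded_on_polydisk_def)
  also have "\<dots> = real N ^ n * B\<^sup>2" by simp
  finally show ?thesis by (simp add: N_def)
qed

lemma sum_le_sqrt_card:
  fixes x :: "'a \<Rightarrow> real"
  shows "(\<Sum>i\<in>A. x i) \<le> sqrt (real (card A)) * sqrt (\<Sum>i\<in>A. (x i)\<^sup>2)"
proof -
  have "(\<Sum>i\<in>A. 1 * x i)\<^sup>2 \<le> (\<Sum>i\<in>A. 1\<^sup>2) * (\<Sum>i\<in>A. (x i)\<^sup>2)"
    by (rule Cauchy_Schwarz_ineq_sum)
  hence "(\<Sum>i\<in>A. x i)\<^sup>2 \<le> real (card A) * (\<Sum>i\<in>A. (x i)\<^sup>2)" by simp
  from real_le_rsqrt[OF this] show ?thesis by (simp add: real_sqrt_mult)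
qed

text \<open>Lowering the exponent at \<open>j\<close> by one is injective. This drop in degree is
  the source of the saving in the small-degree case.\<close>

lemma card_homogeneous_indices_containing:
  assumes "j < n" "m > 0"
  shows "card {\<alpha> \<in> homogeneous_indices n m. \<alpha> j \<noteq> 0} \<le> card (homogeneous_indices n (m - 1))"
proof (rule card_inj_on_le)
  let ?f = "\<lambda>\<alpha>::nat\<Rightarrow>nat. \<alpha>(j := \<alpha> j - 1)"
  show "inj_on ?f {\<alpha> \<in> homogeneous_indices n m. \<alpha> j \<noteq> 0}"
  proof (rule inj_onI)
    fix \<alpha> \<beta> assume a: "\<alpha> \<in> {\<alpha> \<in> homogeneous_indices n m. \<alpha> j \<noteq> 0}"
      "\<beta> \<in> {\<alpha> \<in> homogeneous_indices n m. \<alpha> j \<noteq> 0}" and eq: "?f \<alpha> = ?f \<beta>"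
    have "\<alpha> i = \<beta> i" for i
      using fun_cong[OF eq, of i] a by (cases "i = j") auto
    thus "\<alpha> = \<beta>" by auto
  qed
  show "?f ` {\<alpha> \<in> homogeneous_indices n m. \<alpha> j \<noteq> 0} \<subseteq> homogeneous_indices n (m - 1)"
  proof (rule image_subsetI)
    fix \<alpha> assume "\<alpha> \<in> {\<alpha> \<in> homogeneous_indices n m. \<alpha> j \<noteq> 0}"
    hence a: "\<alpha> \<in> homogeneous_indices n m" "\<alpha> j \<noteq> 0" by auto
    have "(\<Sum>i<n. \<alpha> i) = \<alpha> j + (\<Sum>i\<in>{..<n} - {j}. \<alpha> i)"
      using assms by (intro sum.remove) auto
    moreover have "(\<Sum>i<n. (?f \<alpha>) i) = (?f \<alpha>) j + (\<Sum>i\<in>{..<n} - {j}. (?f \<alpha>) i)"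
      using assms by (intro sum.remove) auto
    ultimately have "(\<Sum>i<n. (?f \<alpha>) i) = m - 1"
      using a by (simp add: homogeneous_indices_def)
    thus "?f \<alpha> \<in> homogeneous_indices n (m - 1)"
      using a assms by (auto simp: homogeneous_indices_def multi_indices_def)
  qed
qed simp

text \<open>Since the exponents of each index add up to \<open>m\<close>, weighting by
  \<open>\<alpha> j\<close> and summing over \<open>j\<close> counts each coefficient
  \<open>m\<close> times. For fixed \<open>j\<close>, Cauchy-Schwarz runs only over indices
  containing \<open>j\<close>, and the L^2 norm of the Euler derivative is replaced by its L^1 norm.
  L^1 norms can be summed over \<open>j\<close> inside the average, where the pointwise bound
  \<open>exp 1 * m * B\<close> applies; the factors \<open>m\<close> cancel.\<close>

lemma homogeneous_sum_coeffs_le: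
  assumes bd: "bounded_on_polydisk n m c B" and m: "m > 0"
  shows "(\<Sum>\<alpha>\<in>homogeneous_indices n m. cmod (c \<alpha>))
    \<le> 3 * exp 1 * 2 ^ m * sqrt (real (card (homogeneous_indices n (m - 1)))) * B"
proof -
  define I where "I = homogeneous_indices n m"
  define N where "N = 2 * m + 1"
  define K where "K = real N ^ n"
  define k where "k = sqrt (real (card (homogeneous_indices n (m - 1))))"
  define R where "R j \<theta> = (\<Sum>\<alpha>\<in>I. (of_nat (\<alpha> j) * c \<alpha>) * monom n (grid_point N \<theta>) \<alpha>)" for j \<theta>
  have "K > 0" by (simp add: K_def N_def)
  have "k \<ge> 0" by (simp add: k_def)
  have fin: "finite I" by (simp add: I_def)
  have j: "K * (\<Sum>\<alpha>\<in>I. real (\<alpha> j) * cmod (c \<alpha>)) \<le> k * (3 * 2 ^ m * (\<Sum>\<theta>\<in>grid n N. cmod (R j \<theta>)))"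
    if "j < n" for j
  proof -
    let ?A = "{\<alpha> \<in> I. \<alpha> j \<noteq> 0}"
    have "(\<Sum>\<alpha>\<in>I. real (\<alpha> j) * cmod (c \<alpha>)) = (\<Sum>\<alpha>\<in>?A. cmod (of_nat (\<alpha> j) * c \<alpha>))"
      using fin by (intro sum.mono_neutral_cong_right) (auto simp: norm_mult)
    also have "\<dots> \<le> sqrt (real (card ?A)) * sqrt (\<Sum>\<alpha>\<in>?A. (cmod (of_nat (\<alpha> j) * c \<alpha>))\<^sup>2)"
      by (rule sum_le_sqrt_card)
    also have "\<dots> \<le> k * sqrt (\<Sum>\<alpha>\<in>I. (cmod (of_nat (\<alpha> j) * c \<alpha>))\<^sup>2)"
      unfolding k_def using card_homogeneous_indices_containing[OF that m] fin
      by (intro mult_mono real_sqrt_le_mono sum_mono2) (auto simp: I_def intro: sum_nonneg)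
    finally have "K * (\<Sum>\<alpha>\<in>I. real (\<alpha> j) * cmod (c \<alpha>)) \<le> k * (K * sqrt (\<Sum>\<alpha>\<in>I. (cmod (of_nat (\<alpha> j) * c \<alpha>))\<^sup>2))"
      using \<open>K > 0\<close> by (simp add: mult.left_commute[of k])
    also have "\<dots> \<le> k * (3 * 2 ^ m * (\<Sum>\<theta>\<in>grid n N. cmod (R j \<theta>)))"
      unfolding K_def R_def I_def using \<open>k \<ge> 0\<close>
      by (intro mult_left_mono homogeneous_L2_le_L1) (auto simp: N_def)
    finally show ?thesis .
  qed
  have "K * real m * (\<Sum>\<alpha>\<in>I. cmod (c \<alpha>)) = K * (\<Sum>\<alpha>\<in>I. \<Sum>j<n. real (\<alpha> j) * cmod (c \<alpha>))"
  proof -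
    have "(\<Sum>j<n. real (\<alpha> j) * cmod (c \<alpha>)) = real m * cmod (c \<alpha>)" if "\<alpha> \<in> I" for \<alpha>
      using that by (simp add: I_def homogeneous_indices_def flip: sum_distrib_right of_nat_sum)
    thus ?thesis by (simp add: mult.assoc flip: sum_distrib_left)
  qed
  also have "\<dots> = (\<Sum>j<n. K * (\<Sum>\<alpha>\<in>I. real (\<alpha> j) * cmod (c \<alpha>)))"
    by (subst sum.swap) (simp add: sum_distrib_left)
  also have "\<dots> \<le> (\<Sum>j<n. k * (3 * 2 ^ m * (\<Sum>\<theta>\<in>grid n N. cmod (R j \<theta>))))"
    by (intro sum_mono j) auto
  also have "\<dots> = k * (3 * 2 ^ m * (\<Sum>\<theta>\<in>grid n N. \<Sum>j<n. cmod (R j \<theta>)))"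
    by (subst sum.swap) (simp add: sum_distrib_left)
  also have "\<dots> \<le> k * (3 * 2 ^ m * (\<Sum>\<theta>\<in>grid n N. exp 1 * real m * B))"
    unfolding R_def I_def using \<open>k \<ge> 0\<close> bd m
    by (intro mult_left_mono sum_mono sum_euler_derivatives_le) auto
  also have "\<dots> = (K * real m) * (3 * exp 1 * 2 ^ m * k * B)"
    by (simp add: K_def)
  finally show ?thesis
    using \<open>K > 0\<close> m by (simp add: I_def k_def)
qed

section \<open>Homogeneous parts of admissible functions\<close>

text \<open>Unordered sums involve arbitrary finite index sets; this enlarges them to truncations by
  degree. The sum of all degrees in \<open>F\<close> bounds each one.\<close>

lemma finite_indices_bounded_degree:
  assumes "finite F" "F \<subseteq> multi_indices n"
  shows "\<exists>M\<ge>m. F \<subseteq> (\<Union>k\<le>M. homogeneous_indices n k)"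
proof -
  define M where "M = max m (\<Sum>\<alpha>\<in>F. \<Sum>i<n. \<alpha> i)"
  have "\<alpha> \<in> (\<Union>k\<le>M. homogeneous_indices n k)" if "\<alpha> \<in> F" for \<alpha>
    using member_le_sum[OF that, of "\<lambda>\<alpha>. \<Sum>i<n. \<alpha> i"] that assms
    by (auto simp: M_def homogeneous_indices_def)
  moreover have "M \<ge> m" by (simp add: M_def)
  ultimately show ?thesis by blast
qed

lemma sum_Union_homogeneous_indices:
  fixes h :: "(nat \<Rightarrow> nat) \<Rightarrow> 'a::comm_monoid_add"
  shows "sum h (\<Union>k\<le>M. homogeneous_indices n k) = (\<Sum>k\<le>M. sum h (homogeneous_indices n k))"
  by (intro sum.UNION_disjoint) (auto, auto simp: homogeneous_indices_def)

text \<open>On the slice \<open>w \<mapsto> f (w x)\<close> the homogeneous parts at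
  \<open>x\<close> become one-variable Taylor coefficients. A truncation of this series is within
  \<open>\<epsilon> / 2\<close> of \<open>f\<close> on the unit circle, so the polynomial
  coefficient bound applies with \<open>R = 1 + \<epsilon> / 2\<close>.\<close>

lemma homogeneous_part_bounded_interior:
  assumes adm: "bohr_admissible n f c" and m: "m > 0" and x: "\<And>i. i < n \<Longrightarrow> cmod (x i) < 1"
  shows "cmod (\<Sum>\<alpha>\<in>homogeneous_indices n m. c \<alpha> * monom n x \<alpha>) \<le> 2 * (1 - cmod (c (\<lambda>_. 0)))"
proof (rule field_le_epsilon)
  fix \<epsilon> :: real assume "\<epsilon> > 0"
  define y where "y w i = (if i < n then w * x i else 0)" for w i
  define g where "g \<alpha> = cmod (c \<alpha> * monom n x \<alpha>)" for \<alpha>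
  define a where "a k = (\<Sum>\<alpha>\<in>homogeneous_indices n k. c \<alpha> * monom n x \<alpha>)" for k
  have mon: "monom n (y w) \<alpha> = monom n (\<lambda>i. w * x i) \<alpha>" for w \<alpha>
    unfolding monom_def y_def by (intro prod.cong) auto
  have norm_h: "cmod (c \<alpha> * monom n (y w) \<alpha>) = g \<alpha>" if "cmod w = 1" for w \<alpha>
    unfolding mon g_def unfolding monom_def using that
    by (simp add: norm_mult power_mult_distrib prod.distrib norm_power flip: prod_norm)
  have yD: "y w \<in> polydisk n 1" if "cmod w = 1" for w
    using x that by (auto simp: polydisk_def y_def norm_mult)
  have hs: "((\<lambda>\<alpha>. c \<alpha> * monom n (y w) \<alpha>) has_sum f (y w)) (multi_indices n)" if "cmod w = 1" for w
    using adm yD[OF that] by (auto simp: bohr_admissible_def)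
  \<comment> \<open>Unordered summability in the complex numbers is absolute, and the moduli of the
    terms do not depend on \<open>w\<close> on the circle, so one tail estimate serves every
    \<open>w\<close>.\<close>
  have "(\<lambda>\<alpha>. cmod (c \<alpha> * monom n (y 1) \<alpha>)) summable_on multi_indices n"
    using has_sum_imp_summable[OF hs[of 1]]
    unfolding summable_on_iff_abs_summable_on_complex by simp
  hence "g summable_on multi_indices n" using norm_h[of 1] by simp
  then obtain G where G: "(g has_sum G) (multi_indices n)"
    by (auto simp: summable_on_def)
  hence "\<forall>\<^sub>F F in finite_subsets_at_top (multi_indices n). dist (sum g F) G < \<epsilon> / 2"
    using half_gt_zero[OF \<open>\<epsilon> > 0\<close>] unfolding has_sum_def tendsto_iff by blast
  then obtain F where F: "finite F" "F \<subseteq> multi_indices n" "dist (sum g F) G < \<epsilon> / 2"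
    unfolding eventually_finite_subsets_at_top by auto
  obtain M where M: "M \<ge> m" "F \<subseteq> (\<Union>k\<le>M. homogeneous_indices n k)"
    using finite_indices_bounded_degree[OF F(1,2)] by blast
  define T where "T = (\<Union>k\<le>M. homogeneous_indices n k)"
  have T: "finite T" "T \<subseteq> multi_indices n" "F \<subseteq> T"
    using M by (auto simp: T_def) (auto simp: homogeneous_indices_def)
  have "sum g F \<le> sum g T" using T by (intro sum_mono2) (auto simp: g_def)
  hence tail: "G - sum g T \<le> \<epsilon> / 2" using F(3) unfolding dist_real_def by linarith
  have bd: "cmod (\<Sum>k\<le>M. a k * w ^ k) \<le> 1 + \<epsilon> / 2" if w: "cmod w = 1" for w
  proof -
    let ?h = "\<lambda>\<alpha>. c \<alpha> * monom n (y w) \<alpha>"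
    have "(?h has_sum (f (y w) - sum ?h T)) (multi_indices n - T)"
      using T by (intro has_sum_Diff hs w has_sum_finite)
    moreover have "(g has_sum (G - sum g T)) (multi_indices n - T)"
      using T by (intro has_sum_Diff G has_sum_finite)
    ultimately have "cmod (f (y w) - sum ?h T) \<le> G - sum g T"
      by (rule norm_infsum_le) (simp add: norm_h[OF w])
    hence "cmod (sum ?h T) \<le> cmod (f (y w)) + \<epsilon> / 2"
      using tail norm_triangle_ineq2[of "sum ?h T" "f (y w)"] by (simp add: norm_minus_commute)
    moreover have "cmod (f (y w)) \<le> 1"
      using adm yD[OF w] by (auto simp: bohr_admissible_def)
    moreover have "sum ?h T = (\<Sum>k\<le>M. a k * w ^ k)"
      unfolding T_def sum_Union_homogeneous_indices a_def sum_distrib_right mon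
      by (intro sum.cong refl) (simp add: monom_scale)
    ultimately show ?thesis by simp
  qed
  have "cmod (a m) \<le> 2 * (1 + \<epsilon> / 2 - cmod (a 0))"
    using bounded_polynomial_coeff_bound[OF bd m M(1)] .
  moreover have "a 0 = c (\<lambda>_. 0)" by (simp add: a_def homogeneous_indices_0 monom_def)
  ultimately show "cmod (\<Sum>\<alpha>\<in>homogeneous_indices n m. c \<alpha> * monom n x \<alpha>)
      \<le> 2 * (1 - cmod (c (\<lambda>_. 0))) + \<epsilon>"
    by (simp add: a_def)
qed

text \<open>Homogeneity at \<open>\<rho> z\<close> gives the bound with a factor
  \<open>\<rho> ^ m\<close>; let \<open>\<rho>\<close> tend to 1 from below.\<close>

lemma homogeneous_part_bounded:
  assumes adm: "bohr_admissible n f c" and m: "m > 0"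
  shows "bounded_on_polydisk n m c (2 * (1 - cmod (c (\<lambda>_. 0))))"
  unfolding bounded_on_polydisk_def
proof safe
  fix z :: "nat \<Rightarrow> complex" assume z: "\<forall>i<n. cmod (z i) \<le> 1"
  define X where "X = cmod (\<Sum>\<alpha>\<in>homogeneous_indices n m. c \<alpha> * monom n z \<alpha>)"
  have "\<rho> ^ m * X \<le> 2 * (1 - cmod (c (\<lambda>_. 0)))" if \<rho>: "0 < \<rho>" "\<rho> < 1" for \<rho> :: real
  proof -
    have "cmod (of_real \<rho> * z i) < 1" if "i < n" for i
    proof -
      have "\<rho> * cmod (z i) \<le> \<rho> * 1" using \<rho> z that by (intro mult_left_mono) auto
      from le_less_trans[OF this, of 1] show ?thesis using \<rho> by (simp add: norm_mult)
    qed
    from homogeneous_part_bounded_interior[OF adm m this]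
    have "cmod (\<Sum>\<alpha>\<in>homogeneous_indices n m. c \<alpha> * (of_real \<rho> ^ m * monom n z \<alpha>)) \<le> 2 * (1 - cmod (c (\<lambda>_. 0)))"
      by (simp add: monom_scale)
    also have "(\<Sum>\<alpha>\<in>homogeneous_indices n m. c \<alpha> * (of_real \<rho> ^ m * monom n z \<alpha>))
       = of_real \<rho> ^ m * (\<Sum>\<alpha>\<in>homogeneous_indices n m. c \<alpha> * monom n z \<alpha>)"
      by (simp add: sum_distrib_left mult_ac)
    finally show ?thesis using \<rho> by (simp add: X_def norm_mult norm_power)
  qed
  hence "\<forall>\<^sub>F \<rho> in at_left 1. \<rho> ^ m * X \<le> 2 * (1 - cmod (c (\<lambda>_. 0)))"
    using eventually_at_left_real[of 0 1] by (auto elim!: eventually_mono)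
  moreover have "((\<lambda>\<rho>. \<rho> ^ m * X) \<longlongrightarrow> 1 ^ m * X) (at_left 1)"
    by (intro tendsto_intros)
  ultimately show "X \<le> 2 * (1 - cmod (c (\<lambda>_. 0)))"
    using tendsto_upperbound[of "\<lambda>\<rho>. \<rho> ^ m * X" "1 ^ m * X" "at_left 1"] by simp
qed

section \<open>Counting multi-indices in terms of n / ln n\<close>

text \<open>The difference of \<open>(1 + y/4)^2\<close> and \<open>y\<close> is the square of
  \<open>1 - y/4\<close>. Applied to \<open>y = ln n / k\<close>, the halved exponent yields
  \<open>(ln n / k)^k \<le> sqrt n\<close>.\<close>

lemma le_exp_half: "y \<le> exp (y / 2)" for y :: real
proof (cases "y \<ge> 0")
  case True
  have "y \<le> (1 + y / 4)\<^sup>2"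
    using zero_le_power2[of "1 - y / 4"] by (simp add: power2_eq_square algebra_simps)
  also have "\<dots> \<le> (exp (y / 4))\<^sup>2"
    using True exp_ge_add_one_self[of "y / 4"] by (intro power_mono) auto
  also have "\<dots> = exp (y / 2)" by (simp add: power2_eq_square flip: exp_add)
  finally show ?thesis .
qed (smt (verit) exp_gt_zero)

lemma exp_of_nat_le: "exp (real k) \<le> 3 ^ k"
  using power_mono[OF exp_le, of k] by (simp flip: exp_of_nat_mult)

text \<open>Both \<open>1\<close> and \<open>n / m\<close> are at most \<open>n / ln n\<close> here;
  the 6 is 2 times the bound 3 for \<open>exp 1\<close>.\<close>

lemma card_homogeneous_indices_le_large_degree:
  assumes n: "n \<ge> 2" and m: "ln (real n) \<le> real m" "m > 0"
  shows "real (card (homogeneous_indices n m)) \<le> (6 * (real n / ln (real n))) ^ m"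
proof -
  define L where "L = ln (real n)"
  have L: "0 < L" "L \<le> real n" using n ln_le_minus_one[of "real n"] by (auto simp: L_def)
  have "real (card (homogeneous_indices n m)) \<le> exp (real m) * (1 + real n / real m) ^ m"
    using n m by (intro card_homogeneous_indices_le) auto
  also have "\<dots> \<le> 3 ^ m * (2 * (real n / L)) ^ m"
  proof (intro mult_mono exp_of_nat_le power_mono)
    have "real n / real m \<le> real n / L" using m L by (intro divide_left_mono) (auto simp: L_def)
    moreover have "1 \<le> real n / L" using L by simp
    ultimately show "1 + real n / real m \<le> 2 * (real n / L)" by linarith
  qed auto
  also have "\<dots> = (6 * (real n / L)) ^ m" by (simp flip: power_mult_distrib)
  finally show ?thesis by (simp add: L_def)
qed

text \<open>Below degree \<open>ln n\<close> the gain of one factor \<open>n\<close> beats the loss \<open>(ln n / k)\<^sup>k \<le> \<surd>n\<close>.\<close>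
lemma card_homogeneous_indices_le_small_degree:
  assumes n: "n \<ge> 2" and k: "real k < ln (real n)"
  shows "real (card (homogeneous_indices n k)) \<le> 2 * (6 * (real n / ln (real n))) ^ Suc k"
proof -
  define L where "L = ln (real n)"
  define x where "x = real n / L"
  have L: "0 < L" "L \<le> real n" using n ln_le_minus_one[of "real n"] by (auto simp: L_def)
  have x: "x \<ge> 1" using L by (simp add: x_def)
  have nL: "real n = exp (L / 2) * exp (L / 2)"
    using n by (simp add: L_def flip: exp_add)
  \<comment> \<open>That is \<open>ln n \<le> 2 sqrt n\<close>, hence
    \<open>sqrt n \<le> 2 x\<close>: one further power of \<open>x\<close> absorbs the loss.\<close>
  have "L \<le> 2 * exp (L / 2)"
    using exp_ge_add_one_self[of "L / 2"] by linarith
  hence "L * exp (L / 2) \<le> 2 * exp (L / 2) * exp (L / 2)"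
    by (intro mult_right_mono) auto
  hence half: "exp (L / 2) \<le> 2 * x"
    using L by (simp add: x_def nL field_simps)
  show ?thesis
  proof (cases "k = 0")
    case True
    thus ?thesis using x by (simp add: homogeneous_indices_0 x_def L_def)
  next
    case False
    have "real (card (homogeneous_indices n k)) \<le> exp (real k) * (1 + real n / real k) ^ k"
      using n False by (intro card_homogeneous_indices_le) auto
    also have "\<dots> \<le> 3 ^ k * (2 * x * (L / real k)) ^ k"
    proof (intro mult_mono exp_of_nat_le power_mono)
      show "1 + real n / real k \<le> 2 * x * (L / real k)"
        using L k False by (simp add: x_def L_def field_simps)
    qed auto
    also have "\<dots> = (6 * x) ^ k * (L / real k) ^ k"
      by (simp add: power_mult_distrib power_divide flip: power_mult_distrib[of 3 2])
    also have "\<dots> \<le> (6 * x) ^ k * (2 * x)"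
    proof (intro mult_left_mono)
      have "(L / real k) ^ k \<le> exp (L / real k / 2) ^ k"
        using L by (intro power_mono le_exp_half) auto
      also have "\<dots> = exp (L / 2)" using False by (simp flip: exp_of_nat_mult)
      finally show "(L / real k) ^ k \<le> 2 * x" using half by linarith
    qed (use x in auto)
    also have "\<dots> \<le> (6 * x) ^ k * (2 * (6 * x))" using x by (intro mult_left_mono) auto
    finally show ?thesis by (simp add: x_def L_def mult_ac)
  qed
qed

text \<open>The degree \<open>ln n\<close> separates plain Cauchy-Schwarz from the derivative
  estimate. The constant is \<open>72 = 9 * 2 * 4\<close>: \<open>3 * exp 1 \<le> 9\<close>, the 2
  from comparing L^2 with L^1, and the 4 from the square root of the count, as
  \<open>2 * 6 \<le> 4^2\<close>.\<close>

lemma homogeneous_sum_coeffs_le_growth: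
  assumes n: "n \<ge> 2" and m: "m > 0" and bd: "bounded_on_polydisk n m c B" and "B \<ge> 0"
  shows "(\<Sum>\<alpha>\<in>homogeneous_indices n m. cmod (c \<alpha>)) \<le> B * (72 * sqrt (real n / ln (real n))) ^ m"
proof -
  define x where "x = real n / ln (real n)"
  have x: "x \<ge> 1" using n ln_le_minus_one[of "real n"] by (simp add: x_def)
  show ?thesis
  proof (cases "ln (real n) \<le> real m")
    case True
    have "(\<Sum>\<alpha>\<in>homogeneous_indices n m. cmod (c \<alpha>))
      \<le> sqrt (real (card (homogeneous_indices n m))) * sqrt (\<Sum>\<alpha>\<in>homogeneous_indices n m. (cmod (c \<alpha>))\<^sup>2)"
      by (rule sum_le_sqrt_card)
    also have "\<dots> \<le> sqrt ((72\<^sup>2 * x) ^ m) * sqrt (B\<^sup>2)"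
    proof (intro mult_mono real_sqrt_le_mono homogeneous_parseval_le bd)
      have "real (card (homogeneous_indices n m)) \<le> (6 * x) ^ m"
        unfolding x_def by (intro card_homogeneous_indices_le_large_degree n True m)
      also have "\<dots> \<le> (72\<^sup>2 * x) ^ m" using x by (intro power_mono) auto
      finally show "real (card (homogeneous_indices n m)) \<le> (72\<^sup>2 * x) ^ m" .
    qed (use x in \<open>auto intro!: sum_nonneg\<close>)
    also have "\<dots> = B * (72 * sqrt x) ^ m"
      using \<open>B \<ge> 0\<close> by (simp add: real_sqrt_power real_sqrt_mult)
    finally show ?thesis by (simp add: x_def)
  next
    case False
    have "sqrt (real (card (homogeneous_indices n (m - 1)))) \<le> sqrt ((4\<^sup>2 * x) ^ m)"
    proof (rule real_sqrt_le_mono)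
      have "real (card (homogeneous_indices n (m - 1))) \<le> 2 * (6 * x) ^ Suc (m - 1)"
        unfolding x_def using False by (intro card_homogeneous_indices_le_small_degree n) auto
      also have "\<dots> = 2 * (6 * x) ^ m" using m by simp
      also have "\<dots> \<le> 2 ^ m * (6 * x) ^ m"
        using m x self_le_power[of "2::real" m] by (intro mult_right_mono) auto
      also have "\<dots> \<le> (4\<^sup>2 * x) ^ m"
        unfolding power_mult_distrib[symmetric] using x by (intro power_mono) auto
      finally show "real (card (homogeneous_indices n (m - 1))) \<le> (4\<^sup>2 * x) ^ m" .
    qed
    hence sq: "sqrt (real (card (homogeneous_indices n (m - 1)))) \<le> 4 ^ m * sqrt x ^ m"
      by (simp add: real_sqrt_power real_sqrt_mult power_mult_distrib)
    have "3 * exp 1 \<le> (9::real)" using exp_le by simp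
    also have "\<dots> \<le> 9 ^ m" using m by (intro self_le_power) auto
    finally have e: "3 * exp 1 \<le> (9::real) ^ m" .
    have "(\<Sum>\<alpha>\<in>homogeneous_indices n m. cmod (c \<alpha>))
      \<le> 3 * exp 1 * 2 ^ m * sqrt (real (card (homogeneous_indices n (m - 1)))) * B"
      using bd m by (rule homogeneous_sum_coeffs_le)
    also have "\<dots> \<le> 9 ^ m * 2 ^ m * (4 ^ m * sqrt x ^ m) * B"
      using e sq x \<open>B \<ge> 0\<close> by (intro mult_right_mono mult_mono) auto
    also have "\<dots> = B * (72 * sqrt x) ^ m"
    proof -
      have "(72::real) ^ m = 9 ^ m * 2 ^ m * 4 ^ m" by (simp flip: power_mult_distrib)
      thus ?thesis by (simp only: power_mult_distrib mult_ac)
    qed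
    finally show ?thesis by (simp add: x_def)
  qed
qed

section \<open>The lower bound\<close>

text \<open>Interpolation between l^1 and l^2. With \<open>y = x i / B\<close>, write
  \<open>y^p\<close> as \<open>y^(2-p)\<close> times \<open>(y^2)^(p-1)\<close> and apply Young's
  inequality with weights \<open>2 - p\<close> and \<open>p - 1\<close> to \<open>y / K\<close> and
  \<open>y^2\<close>; the weights add up to 1.\<close>

lemma sum_powr_interpolation:
  fixes x :: "'a \<Rightarrow> real"
  assumes p: "1 < p" "p < 2" and x: "\<And>i. i \<in> A \<Longrightarrow> x i \<ge> 0" and fin: "finite A"
    and B: "B \<ge> 0" and "K > 0"
    and s1: "(\<Sum>i\<in>A. x i) \<le> B * K" and s2: "(\<Sum>i\<in>A. (x i)\<^sup>2) \<le> B\<^sup>2"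
  shows "(\<Sum>i\<in>A. x i powr p) \<le> B powr p * K powr (2 - p)"
proof (cases "B = 0")
  case True
  hence "(\<Sum>i\<in>A. (x i)\<^sup>2) = 0" using s2 by (intro antisym sum_nonneg) auto
  hence "\<forall>i\<in>A. x i = 0" using fin by (subst (asm) sum_nonneg_eq_0_iff) auto
  thus ?thesis using True by simp
next
  case False
  hence "B > 0" using B by simp
  have pt: "x i powr p \<le> B powr p * K powr (2 - p) * ((2 - p) * (x i / (B * K)) + (p - 1) * ((x i)\<^sup>2 / B\<^sup>2))"
    if "i \<in> A" for i
  proof (cases "x i = 0")
    case False
    define y where "y = x i / B"
    have "y > 0" using False x[OF that] \<open>B > 0\<close> by (simp add: y_def)
    have "x i powr p = B powr p * y powr p"
      using \<open>B > 0\<close> \<open>y > 0\<close> by (simp add: y_def flip: powr_mult)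
    also have "y powr p = y powr (2 - p) * (y\<^sup>2) powr (p - 1)"
      using \<open>y > 0\<close> by (simp add: powr_powr flip: powr_numeral powr_add)
    also have "y powr (2 - p) = K powr (2 - p) * (y / K) powr (2 - p)"
      using \<open>y > 0\<close> \<open>K > 0\<close> by (simp flip: powr_mult)
    also have "B powr p * (K powr (2 - p) * (y / K) powr (2 - p) * (y\<^sup>2) powr (p - 1))
        = B powr p * K powr (2 - p) * ((y / K) powr (2 - p) * (y\<^sup>2) powr (p - 1))"
      by simp
    also have "\<dots> \<le> B powr p * K powr (2 - p) * ((2 - p) * (y / K) + (p - 1) * y\<^sup>2)"
      using p \<open>y > 0\<close> \<open>K > 0\<close> by (intro mult_left_mono Youngs_inequality_0) auto
    finally show ?thesis by (simp add: y_def power_divide)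
  qed (use p in simp)
  have "(\<Sum>i\<in>A. x i powr p)
    \<le> (\<Sum>i\<in>A. B powr p * K powr (2 - p) * ((2 - p) * (x i / (B * K)) + (p - 1) * ((x i)\<^sup>2 / B\<^sup>2)))"
    by (rule sum_mono) (rule pt)
  also have "\<dots> = B powr p * K powr (2 - p) *
      ((2 - p) * ((\<Sum>i\<in>A. x i) / (B * K)) + (p - 1) * ((\<Sum>i\<in>A. (x i)\<^sup>2) / B\<^sup>2))"
    by (simp only: sum_distrib_left[symmetric] sum.distrib sum_divide_distrib)
  also have "\<dots> \<le> B powr p * K powr (2 - p) * ((2 - p) * 1 + (p - 1) * 1)"
    using p s1 s2 \<open>B > 0\<close> \<open>K > 0\<close> by (intro mult_left_mono add_mono) auto
  finally show ?thesis by simp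
qed

lemma powr_power_commute: "(x ^ m) powr a = (x powr a) ^ m" for x a :: real
proof (induction m)
  case (Suc m)
  have "(x ^ Suc m) powr a = x powr a * (x ^ m) powr a"
    unfolding power_Suc by (rule powr_mult)
  thus ?case by (simp only: Suc power_Suc)
qed simp

text \<open>Degree \<open>m \<ge> 1\<close> contributes at most \<open>4 (1 - a) / 5^m\<close>,
  where \<open>a\<close> is the modulus of the constant term. The 1/5 makes these bounds sum to
  \<open>1 - a\<close>, which complements \<open>a^p \<le> a\<close>.\<close>

lemma bohr_cond_small_polydisk:
  fixes p :: real
  assumes p: "1 < p" "p < 2" and n: "n \<ge> 2" and adm: "bohr_admissible n f c"
    and r: "r \<ge> 0" "r powr p * (72 * sqrt (real n / ln (real n))) powr (2 - p) \<le> 1 / 5"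
    and z: "z \<in> polydisk n r"
  shows "bohr_cond p n c z"
proof -
  define a where "a = cmod (c (\<lambda>_. 0))"
  define B where "B = 2 * (1 - a)"
  define K where "K = 72 * sqrt (real n / ln (real n))"
  define g where "g \<alpha> = cmod (c \<alpha> * monom n z \<alpha>) powr p" for \<alpha>
  have "K > 0" using n by (simp add: K_def)
  have bd: "bounded_on_polydisk n m c B" if "m > 0" for m
    using homogeneous_part_bounded[OF adm that] by (simp add: B_def a_def)
  \<comment> \<open>The bound on the degree-one part already forces \<open>B \<ge> 0\<close>, that
    is \<open>a \<le> 1\<close>.\<close>
  have "cmod (\<Sum>\<alpha>\<in>homogeneous_indices n 1. c \<alpha> * monom n (\<lambda>_. 0) \<alpha>) \<le> B"
    using bd[of 1] by (auto simp: bounded_on_polydisk_def)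
  hence "B \<ge> 0" by (rule order_trans[OF norm_ge_zero])
  hence a: "0 \<le> a" "a \<le> 1" by (auto simp: a_def B_def)
  \<comment> \<open>Linear dependence on \<open>1 - a\<close> is what lets the constant term be
    balanced; it uses \<open>1 < p < 2\<close> and \<open>0 \<le> 1 - a \<le> 1\<close>.\<close>
  have Bp: "B powr p \<le> 4 * (1 - a)"
  proof -
    have "B powr p = 2 powr p * (1 - a) powr p"
      unfolding B_def by (rule powr_mult)
    also have "\<dots> \<le> 2 powr 2 * (1 - a) powr 1"
    proof (rule mult_mono)
      show "2 powr p \<le> (2::real) powr 2" using p by (intro powr_mono) auto
      show "(1 - a) powr p \<le> (1 - a) powr 1" using p a by (intro powr_mono') auto
    qed auto
    also have "\<dots> = 4 * (1 - a)" using a by simp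
    finally show ?thesis .
  qed
  have level: "sum g (homogeneous_indices n m) \<le> 4 * (1 - a) * (1 / 5) ^ m" if m: "m > 0" for m
  proof -
    have "sum g (homogeneous_indices n m) \<le> (\<Sum>\<alpha>\<in>homogeneous_indices n m. (r ^ m) powr p * cmod (c \<alpha>) powr p)"
    proof (rule sum_mono)
      fix \<alpha> assume \<alpha>: "\<alpha> \<in> homogeneous_indices n m"
      have "cmod (monom n z \<alpha>) \<le> (\<Prod>i<n. r ^ \<alpha> i)"
        unfolding monom_def prod_norm[symmetric] norm_power using z
        by (intro prod_mono conjI power_mono) (auto simp: polydisk_def less_imp_le)
      also have "\<dots> = r ^ m" using \<alpha> by (simp add: homogeneous_indices_def flip: power_sum)
      finally have "cmod (c \<alpha> * monom n z \<alpha>) \<le> r ^ m * cmod (c \<alpha>)"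
        unfolding norm_mult mult.commute[of "r ^ m"] by (rule mult_left_mono) auto
      hence "g \<alpha> \<le> (r ^ m * cmod (c \<alpha>)) powr p"
        unfolding g_def using p by (intro powr_mono2) auto
      thus "g \<alpha> \<le> (r ^ m) powr p * cmod (c \<alpha>) powr p" using r by (simp add: powr_mult)
    qed
    also have "\<dots> = (r ^ m) powr p * (\<Sum>\<alpha>\<in>homogeneous_indices n m. cmod (c \<alpha>) powr p)"
      by (simp add: sum_distrib_left)
    also have "\<dots> \<le> (r ^ m) powr p * (B powr p * (K ^ m) powr (2 - p))"
    proof (intro mult_left_mono sum_powr_interpolation p \<open>B \<ge> 0\<close>)
      show "(\<Sum>\<alpha>\<in>homogeneous_indices n m. cmod (c \<alpha>)) \<le> B * K ^ m"
        unfolding K_def using n m bd[OF m] \<open>B \<ge> 0\<close> by (rule homogeneous_sum_coeffs_le_growth)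
      show "(\<Sum>\<alpha>\<in>homogeneous_indices n m. (cmod (c \<alpha>))\<^sup>2) \<le> B\<^sup>2"
        using bd[OF m] by (rule homogeneous_parseval_le)
    qed (use \<open>K > 0\<close> in auto)
    also have "\<dots> = B powr p * (r powr p * K powr (2 - p)) ^ m"
      using r \<open>K > 0\<close> by (simp add: powr_power_commute power_mult_distrib)
    also have "\<dots> \<le> (4 * (1 - a)) * (1 / 5) ^ m"
      using Bp a r by (intro mult_mono power_mono) (auto simp: K_def)
    finally show ?thesis .
  qed
  have fin: "sum g F \<le> 1" if F: "finite F" "F \<subseteq> multi_indices n" for F
  proof -
    obtain M where M: "F \<subseteq> (\<Union>k\<le>M. homogeneous_indices n k)"
      using finite_indices_bounded_degree[OF F] by blast
    have "sum g F \<le> sum g (\<Union>k\<le>M. homogeneous_indices n k)"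
      using M by (intro sum_mono2) (auto simp: g_def)
    also have "\<dots> = (\<Sum>k\<le>M. sum g (homogeneous_indices n k))"
      by (rule sum_Union_homogeneous_indices)
    also have "\<dots> = sum g (homogeneous_indices n 0) + (\<Sum>k<M. sum g (homogeneous_indices n (Suc k)))"
      by (simp add: sum.atMost_shift)
    also have "\<dots> \<le> a powr p + (\<Sum>k<M. 4 * (1 - a) * (1 / 5) ^ Suc k)"
    proof (intro add_mono sum_mono)
      show "sum g (homogeneous_indices n 0) \<le> a powr p"
        by (simp add: homogeneous_indices_0 g_def monom_def a_def)
      show "sum g (homogeneous_indices n (Suc k)) \<le> 4 * (1 - a) * (1 / 5) ^ Suc k" for k
        by (rule level) simp
    qed
    also have "(\<Sum>k<M. 4 * (1 - a) * (1 / 5) ^ Suc k) = (1 - a) * (1 - (1 / 5) ^ M)"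
    proof -
      have "(\<Sum>k<M. 4 * (1 - a) * (1 / 5) ^ Suc k) = 4 * (1 - a) / 5 * (\<Sum>k<M. (1 / 5) ^ k)"
        by (simp add: sum_distrib_left)
      also have "(\<Sum>k<M. (1 / 5 :: real) ^ k) = (1 - (1 / 5) ^ M) * (5 / 4)"
        by (simp add: sum_gp_strict)
      also have "4 * (1 - a) / 5 * (x * (5 / 4)) = (1 - a) * x" for x
        by (simp add: field_simps)
      finally show ?thesis .
    qed
    also have "\<dots> \<le> (1 - a) * 1" using a by (intro mult_left_mono) auto
    also have "a powr p \<le> a powr 1" using a p by (intro powr_mono') auto
    finally show ?thesis using a by simp
  qed
  have "g summable_on multi_indices n"
    using fin by (intro nonneg_bdd_above_summable_on) (auto simp: g_def intro!: bdd_aboveI)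
  moreover from this have "infsum g (multi_indices n) \<le> 1"
    using fin by (rule infsum_le_finite_sums)
  moreover have "g = (\<lambda>\<alpha>. cmod (c \<alpha> * monom n z \<alpha>) powr p)"
    by (rule ext) (simp add: g_def)
  ultimately show ?thesis by (simp add: bohr_cond_def)
qed

lemma bohr_radius_lower_bound:
  fixes p :: real
  assumes p: "1 < p" "p < 2"
  shows "\<exists>C>0. \<forall>n\<ge>2. ereal (C * (ln (real n) / real n) powr ((2 - p) / (2 * p))) \<le> bohr_radius p n"
proof -
  \<comment> \<open>Chosen to solve \<open>C powr p * 72 powr (2 - p) = 1 / 5\<close>; the powers of
    \<open>n / ln n\<close> cancel on their own.\<close>
  define C :: real where "C = (1 / (5 * 72 powr (2 - p))) powr (1 / p)"
  have "C > 0" by (simp add: C_def)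
  have Cp: "C powr p * 72 powr (2 - p) = 1 / 5"
    using p by (simp add: C_def powr_powr)
  have "ereal (C * (ln (real n) / real n) powr ((2 - p) / (2 * p))) \<le> bohr_radius p n" if n: "n \<ge> 2" for n
  proof -
    define y where "y = ln (real n) / real n"
    have "y > 0" using n by (simp add: y_def)
    define r where "r = C * y powr ((2 - p) / (2 * p))"
    have "r \<ge> 0" using \<open>C > 0\<close> by (simp add: r_def)
    have rp: "r powr p = C powr p * y powr ((2 - p) / 2)"
      using p \<open>C > 0\<close> by (simp add: r_def powr_mult powr_powr)
    have Kp: "(72 * sqrt (real n / ln (real n))) powr (2 - p) = 72 powr (2 - p) * (1 / y) powr ((2 - p) / 2)"
      using n by (simp add: y_def powr_mult powr_half_sqrt[symmetric] powr_powr)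
    have yy: "y powr ((2 - p) / 2) * (1 / y) powr ((2 - p) / 2) = 1"
      using \<open>y > 0\<close> by (simp flip: powr_mult)
    have "r powr p * (72 * sqrt (real n / ln (real n))) powr (2 - p)
       = (C powr p * 72 powr (2 - p)) * (y powr ((2 - p) / 2) * (1 / y) powr ((2 - p) / 2))"
      unfolding rp Kp by (simp only: mult_ac)
    also have "\<dots> = 1 / 5" unfolding Cp yy by simp
    finally have "r powr p * (72 * sqrt (real n / ln (real n))) powr (2 - p) = 1 / 5" .
    hence "ereal r \<le> bohr_radius_f p n c" if "bohr_admissible n f c" for f c
      unfolding bohr_radius_f_def using \<open>r \<ge> 0\<close> bohr_cond_small_polydisk[OF p n that]
      by (intro SUP_upper) auto
    thus ?thesis
      unfolding bohr_radius_def r_def y_def by (intro INF_greatest) auto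
  qed
  thus ?thesis using \<open>C > 0\<close> by blast
qed

section \<open>The upper bound\<close>

text \<open>Each stage applies the unnormalised q by q Fourier matrix and then multiplies entrywise
  by the next block of \<open>q\<close> variables.\<close>

primrec fourier_chain :: "nat \<Rightarrow> (nat \<Rightarrow> complex) \<Rightarrow> nat \<Rightarrow> nat \<Rightarrow> complex" where
  "fourier_chain q z 0 k = z k"
| "fourier_chain q z (Suc t) k =
    z (Suc t * q + k) * (\<Sum>l<q. fourier_chain q z t l * unity_root q k ^ l)"

text \<open>The Fourier matrix is \<open>sqrt q\<close> times a unitary one and the entrywise
  factors are at most 1, so each stage multiplies the squared norm by at most
  \<open>q\<close>.\<close>

lemma fourier_chain_L2:
  assumes z: "\<And>i. cmod (z i) \<le> 1"
  shows "(\<Sum>k<q. (cmod (fourier_chain q z t k))\<^sup>2) \<le> real q ^ Suc t"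
proof (induction t)
  case 0
  have "(\<Sum>k<q. (cmod (z k))\<^sup>2) \<le> (\<Sum>k<q. 1)"
    using z by (intro sum_mono) (simp add: power_le_one)
  thus ?case by simp
next
  case (Suc t)
  have "(\<Sum>k<q. (cmod (fourier_chain q z (Suc t) k))\<^sup>2)
     \<le> (\<Sum>k<q. (cmod (\<Sum>l<q. fourier_chain q z t l * unity_root q k ^ l))\<^sup>2)"
    using z by (intro sum_mono power_mono) (auto simp: norm_mult intro!: mult_left_le_one_le)
  also have "\<dots> = real q * (\<Sum>l<q. (cmod (fourier_chain q z t l))\<^sup>2)"
    by (rule sum_norm_squared_orthogonal) (auto simp: unity_root_orthogonal simp del: complex_cnj_power)
  also have "\<dots> \<le> real q * real q ^ Suc t"
    using Suc by (intro mult_left_mono) auto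
  finally show ?case by simp
qed

section \<open>Expansion of the Fourier chain into monomials\<close>

fun phase :: "nat \<Rightarrow> nat list \<Rightarrow> complex" where
  "phase q (k # l # w) = phase q (l # w) * unity_root q k ^ l"
| "phase q _ = 1"

text \<open>The head of a word is the choice made in the highest block, so prefixing a letter
  matches one more stage of the chain.\<close>

primrec word_index :: "nat \<Rightarrow> nat list \<Rightarrow> nat \<Rightarrow> nat" where
  "word_index q [] = (\<lambda>_. 0)"
| "word_index q (k # w) = (word_index q w)(length w * q + k := 1)"

definition words :: "nat \<Rightarrow> nat \<Rightarrow> nat list set" where
  "words q t = {w. set w \<subseteq> {..<q} \<and> length w = t}"

lemma finite_words [simp]: "finite (words q t)"
  by (simp add: words_def finite_lists_length_eq)

lemma card_words: "card (words q t) = q ^ t"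
  by (simp add: words_def card_lists_length_eq)

lemma sum_words_Suc: "(\<Sum>w\<in>words q (Suc t). h w) = (\<Sum>l<q. \<Sum>w\<in>words q t. h (l # w))"
proof -
  have "words q (Suc t) = (\<lambda>(l, w). l # w) ` ({..<q} \<times> words q t)"
    by (auto simp: words_def length_Suc_conv)
  moreover have "inj_on (\<lambda>(l, w). l # w) ({..<q} \<times> words q t)"
    by (auto simp: inj_on_def)
  ultimately show ?thesis
    by (simp add: sum.reindex sum.cartesian_product case_prod_unfold)
qed

lemma norm_phase [simp]: "cmod (phase q w) = 1"
  by (induction q w rule: phase.induct) (auto simp: norm_mult norm_power)

lemma word_index_eq_0:
  assumes "set w \<subseteq> {..<q}" "i \<ge> length w * q"
  shows "word_index q w i = 0"
  using assms by (induction w) auto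

lemma monom_fun_upd_one:
  assumes "i < n" "\<beta> i = 0"
  shows "monom n z (\<beta>(i := 1)) = z i * monom n z \<beta>"
proof -
  have "monom n z (\<beta>(i := 1)) = (\<Prod>j<n. (if j = i then z i else 1) * z j ^ \<beta> j)"
    unfolding monom_def using assms by (intro prod.cong) auto
  thus ?thesis using assms by (simp add: prod.distrib prod.delta monom_def)
qed

lemma monom_word_index_Cons:
  assumes "w \<in> words q t" "k < q" "Suc t * q \<le> n"
  shows "monom n z (word_index q (k # w)) = z (t * q + k) * monom n z (word_index q w)"
  unfolding word_index.simps using assms
  by (subst monom_fun_upd_one) (auto simp: words_def intro!: word_index_eq_0)

lemma word_index_in_homogeneous_indices:
  assumes "w \<in> words q t" "t * q \<le> n"
  shows "word_index q w \<in> homogeneous_indices n t"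
  using assms
proof (induction w arbitrary: t)
  case Nil
  thus ?case by (auto simp: words_def homogeneous_indices_def multi_indices_def)
next
  case (Cons k w)
  then obtain s where s: "t = Suc s" "w \<in> words q s" "k < q" by (auto simp: words_def)
  define \<beta> where "\<beta> = word_index q w"
  define i where "i = s * q + k"
  have i: "i < n" "length w = s" using s Cons.prems by (auto simp: i_def words_def)
  have "\<beta> i = 0" using s by (auto simp: \<beta>_def i_def words_def intro!: word_index_eq_0)
  have \<beta>: "\<beta> \<in> homogeneous_indices n s" unfolding \<beta>_def using s Cons.prems by (intro Cons.IH) auto
  have "(\<Sum>j<n. (\<beta>(i := 1)) j) = (\<Sum>j<n. (if j = i then 1 else 0) + \<beta> j)"
    using \<open>\<beta> i = 0\<close> by (intro sum.cong) auto
  also have "\<dots> = Suc s" using i \<beta> by (simp add: sum.distrib homogeneous_indices_def)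
  finally show ?case
    using s \<beta> i by (simp add: homogeneous_indices_def multi_indices_def flip: \<beta>_def i_def)
qed

text \<open>The highest block contains a single 1, at the position of the head letter, so words can
  be read back. Hence no two terms of the form share a monomial, and \<open>q ^ m\<close> unimodular
  coefficients really occur.\<close>

lemma inj_on_word_index: "inj_on (word_index q) (words q t)"
proof (induction t)
  case (Suc t)
  show ?case
  proof (rule inj_onI)
    fix v w assume "v \<in> words q (Suc t)" "w \<in> words q (Suc t)" and eq: "word_index q v = word_index q w"
    then obtain k v' l w' where vw: "v = k # v'" "w = l # w'" "v' \<in> words q t" "w' \<in> words q t" "k < q" "l < q"
      by (auto simp: words_def length_Suc_conv)
    have len: "length v' = t" "length w' = t" using vw by (auto simp: words_def)
    have z: "word_index q v' (t * q + j) = 0" "word_index q w' (t * q + j) = 0" for j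
      using vw by (auto simp: words_def intro!: word_index_eq_0)
    have "k = l" using fun_cong[OF eq, of "t * q + k"] z len by (auto simp: vw split: if_splits)
    have "word_index q v' i = word_index q w' i" for i
      using fun_cong[OF eq, of i] z len \<open>k = l\<close> by (cases "i = t * q + k") (auto simp: vw)
    hence "word_index q v' = word_index q w'" by (rule ext)
    hence "v' = w'" using Suc vw by (auto dest: inj_onD)
    thus "v = w" using vw \<open>k = l\<close> by simp
  qed
qed (auto simp: words_def inj_on_def)

lemma fourier_chain_eq:
  assumes "Suc t * q \<le> n" "k < q"
  shows "fourier_chain q z t k = (\<Sum>w\<in>words q t. phase q (k # w) * monom n z (word_index q (k # w)))"
  using assms
proof (induction t arbitrary: k)
  case 0
  have "monom n z (word_index q [k]) = z k"
    unfolding word_index.simps using 0 by (subst monom_fun_upd_one) (auto simp: monom_def)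
  moreover have "words q 0 = {[]}" by (auto simp: words_def)
  ultimately show ?case by (simp del: word_index.simps)
next
  case (Suc t)
  have "(\<Sum>w\<in>words q (Suc t). phase q (k # w) * monom n z (word_index q (k # w)))
     = (\<Sum>w\<in>words q (Suc t). phase q (k # w) * (z (Suc t * q + k) * monom n z (word_index q w)))"
    using Suc.prems by (intro sum.cong refl arg_cong2[where f = "(*)"] monom_word_index_Cons) auto
  also have "\<dots> = (\<Sum>l<q. \<Sum>w\<in>words q t. z (Suc t * q + k) * (phase q (l # w) * monom n z (word_index q (l # w)) * unity_root q k ^ l))"
    unfolding sum_words_Suc by (intro sum.cong refl) (simp del: word_index.simps add: mult_ac)
  also have "\<dots> = z (Suc t * q + k) * (\<Sum>l<q. fourier_chain q z t l * unity_root q k ^ l)"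
    using Suc.prems by (simp add: Suc.IH sum_distrib_left sum_distrib_right del: word_index.simps)
  finally show ?case unfolding fourier_chain.simps by (rule sym)
qed

text \<open>The multilinear form \<open>\<Sum> \<omega>\<^bsup>k\<^sub>1k\<^sub>2 + k\<^sub>2k\<^sub>3 + \<dots>\<^esup> z\<^sub>1\<^sub>,\<^sub>k\<^sub>1 \<dots> z\<^sub>m\<^sub>,\<^sub>k\<^sub>m\<close> in \<open>m\<close> blocks of \<open>q\<close> variables,
  where \<open>\<omega>\<close> is a primitive \<open>q\<close>-th root of unity.\<close>
definition block_form :: "nat \<Rightarrow> nat \<Rightarrow> nat \<Rightarrow> (nat \<Rightarrow> complex) \<Rightarrow> complex" where
  "block_form n q m z = (\<Sum>w\<in>words q m. phase q w * monom n z (word_index q w))"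

text \<open>The form is the sum of the entries of the last stage; Cauchy-Schwarz costs
  \<open>sqrt q\<close> on top of the L^2 bound.\<close>

lemma norm_block_form_le:
  assumes "m > 0" "m * q \<le> n" and z: "\<And>i. cmod (z i) \<le> 1"
  shows "cmod (block_form n q m z) \<le> sqrt (real q ^ (m + 1))"
proof -
  obtain t where t: "m = Suc t" using assms gr0_conv_Suc by blast
  have "block_form n q m z = (\<Sum>k<q. fourier_chain q z t k)"
    unfolding block_form_def t sum_words_Suc using assms t
    by (intro sum.cong refl fourier_chain_eq[symmetric]) auto
  hence "cmod (block_form n q m z) \<le> (\<Sum>k<q. cmod (fourier_chain q z t k))"
    by (simp add: norm_sum)
  also have "\<dots> \<le> sqrt (real (card {..<q})) * sqrt (\<Sum>k<q. (cmod (fourier_chain q z t k))\<^sup>2)"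
    by (rule sum_le_sqrt_card)
  also have "\<dots> \<le> sqrt (real q) * sqrt (real q ^ m)"
    using fourier_chain_L2[of z q t] z t by (intro mult_mono real_sqrt_le_mono) (auto intro: sum_nonneg)
  also have "\<dots> = sqrt (real q ^ (m + 1))" by (simp flip: real_sqrt_mult)
  finally show ?thesis .
qed

lemma holomorphic_monom_slice: "(\<lambda>w. monom n (z(i := w)) \<alpha>) holomorphic_on UNIV"
  unfolding monom_def
proof (rule holomorphic_on_prod)
  fix j
  show "(\<lambda>w. (z(i := w)) j ^ \<alpha> j) holomorphic_on UNIV"
    by (cases "j = i") (auto intro!: holomorphic_intros)
qed

text \<open>Divide the form by its sup bound. At the diagonal point all \<open>q ^ m\<close> nonzero
  terms have equal modulus, so the Bohr condition becomes one inequality in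
  \<open>\<rho>\<close>.\<close>

lemma block_form_admissible:
  fixes p :: real
  assumes q: "q > 0" and m: "m > 0" and n: "m * q \<le> n"
  shows "\<exists>f c. bohr_admissible n f c \<and>
    (\<forall>\<rho>\<ge>0. bohr_cond p n c (\<lambda>i. if i < n then of_real \<rho> else 0) \<longrightarrow>
      real q ^ m * (\<rho> ^ m / sqrt (real q ^ (m + 1))) powr p \<le> 1)"
proof -
  define R where "R = sqrt (real q ^ (m + 1))"
  have "R > 0" using q by (simp add: R_def)
  define V where "V = word_index q ` words q m"
  define c where "c \<alpha> = (if \<alpha> \<in> V then phase q (inv_into (words q m) (word_index q) \<alpha>) / of_real R else 0)" for \<alpha>
  define f where "f z = block_form n q m z / of_real R" for z
  have c_word: "c (word_index q w) = phase q w / of_real R" if "w \<in> words q m" for w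
    using that by (simp add: c_def V_def inv_into_f_f[OF inj_on_word_index])
  have V: "finite V" "V \<subseteq> homogeneous_indices n m"
    using word_index_in_homogeneous_indices[OF _ n] by (auto simp: V_def)
  hence V': "V \<subseteq> multi_indices n" by (auto simp: homogeneous_indices_def)
  have sumV: "(\<Sum>\<alpha>\<in>V. h \<alpha>) = (\<Sum>w\<in>words q m. h (word_index q w))" for h :: "_ \<Rightarrow> 'b::comm_monoid_add"
    unfolding V_def using inj_on_word_index by (simp add: sum.reindex)
  have adm: "bohr_admissible n f c"
    unfolding bohr_admissible_def
  proof (intro conjI ballI allI impI)
    fix z i assume "z \<in> polydisk n 1" "i < n"
    have "(\<lambda>w. f (z(i := w))) holomorphic_on UNIV"
      unfolding f_def block_form_def using \<open>R > 0\<close>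
      by (intro holomorphic_intros holomorphic_monom_slice) auto
    thus "(\<lambda>w. f (z(i := w))) field_differentiable at (z i)"
      by (rule holomorphic_on_imp_differentiable_at) auto
  next
    fix z assume "z \<in> polydisk n 1"
    show "((\<lambda>\<alpha>. c \<alpha> * monom n z \<alpha>) has_sum f z) (multi_indices n)"
    proof (rule has_sum_finite_neutralI[OF V(1) V'])
      show "f z = (\<Sum>\<alpha>\<in>V. c \<alpha> * monom n z \<alpha>)"
        by (simp add: sumV c_word f_def block_form_def sum_divide_distrib)
    qed (auto simp: c_def)
  next
    fix z assume z: "z \<in> polydisk n 1"
    have "cmod (z i) \<le> 1" for i using z by (cases "i < n") (auto simp: polydisk_def less_imp_le)
    hence "cmod (block_form n q m z) \<le> R" unfolding R_def by (intro norm_block_form_le m n)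
    thus "cmod (f z) \<le> 1" using \<open>R > 0\<close> by (simp add: f_def norm_divide)
  qed
  have "real q ^ m * (\<rho> ^ m / R) powr p \<le> 1"
    if \<rho>: "\<rho> \<ge> 0" and cond: "bohr_cond p n c (\<lambda>i. if i < n then of_real \<rho> else 0)" for \<rho>
  proof -
    define z :: "nat \<Rightarrow> complex" where "z = (\<lambda>i. if i < n then of_real \<rho> else 0)"
    have mon: "monom n z \<alpha> = of_real \<rho> ^ m" if "\<alpha> \<in> V" for \<alpha>
      using V that by (auto simp: monom_def z_def homogeneous_indices_def simp flip: power_sum)
    have term_eq: "cmod (c \<alpha> * monom n z \<alpha>) = \<rho> ^ m / R" if "\<alpha> \<in> V" for \<alpha>
      using that \<rho> \<open>R > 0\<close> by (simp add: mon norm_mult norm_power c_def norm_divide)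
    have "((\<lambda>\<alpha>. cmod (c \<alpha> * monom n z \<alpha>) powr p) has_sum (\<Sum>\<alpha>\<in>V. cmod (c \<alpha> * monom n z \<alpha>) powr p)) (multi_indices n)"
      by (rule has_sum_finite_neutralI[OF V(1) V']) (auto simp: c_def)
    hence "(\<Sum>\<alpha>\<in>V. cmod (c \<alpha> * monom n z \<alpha>) powr p) \<le> 1"
      using cond by (simp add: bohr_cond_def infsumI flip: z_def)
    also have "(\<Sum>\<alpha>\<in>V. cmod (c \<alpha> * monom n z \<alpha>) powr p) = (\<Sum>\<alpha>\<in>V. (\<rho> ^ m / R) powr p)"
      by (intro sum.cong refl) (simp add: term_eq)
    also have "\<dots> = real q ^ m * (\<rho> ^ m / R) powr p"
      by (simp add: V_def card_image[OF inj_on_word_index] card_words)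
    finally show ?thesis .
  qed
  thus ?thesis using adm unfolding R_def by blast
qed

section \<open>Radius bound and choice of block sizes\<close>

text \<open>Solving the inequality for \<open>\<rho>\<close> gives \<open>q^(1/(2m))\<close> times
  \<open>q^(-s)\<close> with \<open>s = 1/p - 1/2\<close>. The hypothesis
  \<open>q \<le> exp m\<close> bounds the first factor by \<open>exp (1/2)\<close>.\<close>

lemma block_radius_le:
  fixes p \<rho> :: real
  assumes p: "1 < p" "p < 2" and q: "q > 0" "real q \<le> exp (real m)" and m: "m > 0" and "\<rho> \<ge> 0"
    and le: "real q ^ m * (\<rho> ^ m / sqrt (real q ^ (m + 1))) powr p \<le> 1"
  shows "\<rho> \<le> exp (1 / 2) * real q powr (- ((2 - p) / (2 * p)))"
proof (rule ccontr)
  define s where "s = (2 - p) / (2 * p)"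
  define b where "b = exp (1 / 2) * real q powr (- s)"
  assume "\<not> ?thesis"
  hence "b < \<rho>" by (simp add: b_def s_def)
  have s: "s + 1 / 2 = 1 / p" using p by (simp add: s_def field_simps)
  have "b > 0" using q by (simp add: b_def)
  have "real q powr (real (m + 1) / 2) = (real q powr real (m + 1)) powr (1 / 2)"
    unfolding powr_powr by simp
  also have "\<dots> = sqrt (real q powr real (m + 1))" by (intro powr_half_sqrt) simp
  also have "real q powr real (m + 1) = real q ^ (m + 1)" using q by (intro powr_realpow) simp
  finally have sq: "real q powr (real (m + 1) / 2) = sqrt (real q ^ (m + 1))" .
  have "sqrt (real q) \<le> exp (real m / 2)"
  proof (rule real_le_lsqrt)
    show "real q \<le> (exp (real m / 2))\<^sup>2" using q by (simp add: power2_eq_square flip: exp_add)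
  qed auto
  hence "real q powr (1 / 2) * real q powr (- s * real m) \<le> exp (real m / 2) * real q powr (- s * real m)"
    by (intro mult_right_mono) (simp_all add: powr_half_sqrt)
  also have "\<dots> = b ^ m"
    using q by (simp add: b_def power_mult_distrib powr_powr flip: exp_of_nat_mult powr_realpow)
  also have "\<dots> < \<rho> ^ m" using \<open>b < \<rho>\<close> \<open>b > 0\<close> m by (intro power_strict_mono) auto
  finally have "real q powr (1 / 2) * real q powr (- s * real m) / real q powr (real (m + 1) / 2)
      < \<rho> ^ m / real q powr (real (m + 1) / 2)"
    using q by (intro divide_strict_right_mono) auto
  also note sq
  also have "real q powr (1 / 2) * real q powr (- s * real m) / sqrt (real q ^ (m + 1)) = real q powr (- (real m / p))"
  proof -
    have "1 / 2 + - s * real m - real (m + 1) / 2 = - (real m * (s + 1 / 2))" by (simp add: field_simps)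
    also have "\<dots> = - (real m / p)" unfolding s by simp
    finally have "real q powr (1 / 2) * real q powr (- s * real m) / real q powr (real (m + 1) / 2) = real q powr (- (real m / p))"
      using q by (simp flip: powr_add powr_diff)
    thus ?thesis unfolding sq .
  qed
  finally have "(real q powr (- (real m / p))) powr p < (\<rho> ^ m / sqrt (real q ^ (m + 1))) powr p"
    using p by (intro powr_less_mono2) auto
  also have "(real q powr (- (real m / p))) powr p = real q powr (- real m)"
    unfolding powr_powr using p by simp
  also have "\<dots> = inverse (real q ^ m)"
    using q by (simp add: powr_minus powr_realpow)
  finally have "real q ^ m * inverse (real q ^ m) < real q ^ m * (\<rho> ^ m / sqrt (real q ^ (m + 1))) powr p"
    using q by (intro mult_strict_left_mono) auto
  thus False using le q by simp
qed

text \<open>Take \<open>m\<close> as \<open>ln n\<close> rounded up and \<open>q = n div m\<close>.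
  Rounding costs a factor 3 in \<open>m\<close> (since \<open>ln n \<ge> 1/2\<close>) and 2 in
  \<open>q\<close>, whence the 6; and \<open>q \<le> n = exp (ln n)\<close>.\<close>

lemma block_sizes_exist:
  assumes n: "n \<ge> (2::nat)"
  shows "\<exists>m q. m > 0 \<and> q > 0 \<and> m * q \<le> n \<and> real q \<le> exp (real m) \<and> real n / (6 * ln (real n)) \<le> real q"
proof -
  define L where "L = ln (real n)"
  have "L \<ge> ln 2" using n by (simp add: L_def)
  moreover have "ln 2 \<ge> (1 / 2 :: real)" using ln2_ge_two_thirds by simp
  ultimately have L: "L \<ge> 1 / 2" by simp
  define m where "m = nat \<lceil>L\<rceil>"
  define q where "q = n div m"
  have m: "m > 0" "L \<le> real m" "real m \<le> 3 * L" "m \<le> n"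
  proof -
    show "m > 0" using L by (simp add: m_def)
    show "L \<le> real m" by (simp add: m_def real_nat_ceiling_ge)
    have up: "real m < L + 1" using L unfolding m_def by linarith
    thus "real m \<le> 3 * L" using L by linarith
    have "L \<le> real n - 1" using n ln_le_minus_one[of "real n"] by (simp add: L_def)
    hence "real m < real n" using up by linarith
    thus "m \<le> n" by simp
  qed
  have "q > 0" using m by (simp add: q_def div_greater_zero_iff)
  have "m * q \<le> n" by (simp add: q_def)
  have "n < m * (q + 1)" using m(1) unfolding q_def by (simp add: dividend_less_times_div)
  also have "\<dots> \<le> m * (2 * q)" using \<open>q > 0\<close> by (intro mult_left_mono) auto
  finally have "real n \<le> real (m * (2 * q))" by (intro of_nat_mono less_imp_le)
  also have "\<dots> = real m * (2 * real q)" by simp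
  also have "\<dots> \<le> 3 * L * (2 * real q)" using m by (intro mult_right_mono) auto
  finally have "real n / (6 * L) \<le> real q" using L by (simp add: field_simps)
  have "q \<le> n" by (simp add: q_def)
  hence "real q \<le> exp L" using n by (simp add: L_def)
  also have "\<dots> \<le> exp (real m)" using m by simp
  finally show ?thesis
    using m \<open>q > 0\<close> \<open>m * q \<le> n\<close> \<open>real n / (6 * L) \<le> real q\<close> unfolding L_def by blast
qed

lemma bohr_radius_upper_bound:
  fixes p :: real
  assumes p: "1 < p" "p < 2"
  shows "\<exists>D>0. \<forall>n\<ge>2. bohr_radius p n \<le> ereal (D * (ln (real n) / real n) powr ((2 - p) / (2 * p)))"
proof -
  define s where "s = (2 - p) / (2 * p)"
  have "s > 0" using p by (simp add: s_def)
  define D where "D = exp (1 / 2) * 6 powr s"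
  have "D > 0" by (simp add: D_def)
  have "bohr_radius p n \<le> ereal (D * (ln (real n) / real n) powr s)" if n: "n \<ge> 2" for n
  proof -
    obtain m q where mq: "m > 0" "q > 0" "m * q \<le> n" "real q \<le> exp (real m)"
      "real n / (6 * ln (real n)) \<le> real q"
      using block_sizes_exist[OF n] by blast
    obtain f c where adm: "bohr_admissible n f c"
      and cond: "\<And>\<rho>. \<rho> \<ge> 0 \<Longrightarrow> bohr_cond p n c (\<lambda>i. if i < n then of_real \<rho> else 0) \<Longrightarrow>
        real q ^ m * (\<rho> ^ m / sqrt (real q ^ (m + 1))) powr p \<le> 1"
      using block_form_admissible[OF mq(2,1,3)] by blast
    have "ln (real n) > 0" using n by simp
    have "real q powr (- s) \<le> (real n / (6 * ln (real n))) powr (- s)"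
      using mq(5) n \<open>s > 0\<close> by (intro powr_mono2') auto
    also have "\<dots> = (6 * (ln (real n) / real n)) powr s"
      using n by (simp add: powr_minus powr_divide powr_mult)
    also have "\<dots> = 6 powr s * (ln (real n) / real n) powr s" by (rule powr_mult)
    finally have qs: "exp (1 / 2) * real q powr (- s) \<le> D * (ln (real n) / real n) powr s"
      by (simp add: D_def)
    have "r \<le> D * (ln (real n) / real n) powr s" if "r \<ge> 0" and r: "\<forall>z\<in>polydisk n r. bohr_cond p n c z" for r
    \<comment> \<open>The polydisk of radius \<open>r\<close> is open and omits the diagonal point
      at \<open>r\<close>, so the condition is tested at every \<open>x < r\<close>.\<close>
    proof (rule dense_le)
      fix x assume "x < r"
      show "x \<le> D * (ln (real n) / real n) powr s"
      proof (cases "x \<ge> 0")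
        case True
        hence "(\<lambda>i. if i < n then of_real x else 0) \<in> polydisk n r"
          using \<open>x < r\<close> by (auto simp: polydisk_def)
        hence "real q ^ m * (x ^ m / sqrt (real q ^ (m + 1))) powr p \<le> 1"
          using r True by (intro cond) auto
        from block_radius_le[OF p mq(2,4,1) True this] show ?thesis
          using qs by (simp add: s_def)
      next
        case False
        thus ?thesis using \<open>D > 0\<close> by (smt (verit) mult_nonneg_nonneg powr_ge_zero)
      qed
    qed
    hence "bohr_radius_f p n c \<le> ereal (D * (ln (real n) / real n) powr s)"
      unfolding bohr_radius_f_def by (intro SUP_least) auto
    thus ?thesis
      unfolding bohr_radius_def using adm by (intro INF_lower2[of "(f, c)"]) auto
  qed
  thus ?thesis using \<open>D > 0\<close> unfolding s_def by blast
qed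

theorem theorem1p4:
  fixes p :: real
  assumes "1 < p" and "p < 2"
  shows "\<exists>C D :: real. C > 0 \<and> D > 0 \<and>
    (\<forall>n::nat. n > 1 \<longrightarrow>
       ereal (C * (ln (real n) / real n) powr ((2 - p) / (2 * p))) \<le> bohr_radius p n \<and>
       bohr_radius p n \<le> ereal (D * (ln (real n) / real n) powr ((2 - p) / (2 * p))))"
proof -
  obtain C where "C > 0"
    "\<And>n. n \<ge> 2 \<Longrightarrow> ereal (C * (ln (real n) / real n) powr ((2 - p) / (2 * p))) \<le> bohr_radius p n"
    using bohr_radius_lower_bound[OF assms] by auto
  moreover obtain D where "D > 0"
    "\<And>n. n \<ge> 2 \<Longrightarrow> bohr_radius p n \<le> ereal (D * (ln (real n) / real n) powr ((2 - p) / (2 * p)))"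
    using bohr_radius_upper_bound[OF assms] by auto
  ultimately show ?thesis
    by (intro exI[of _ C] exI[of _ D] conjI allI impI) simp_all
qed

end
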